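(* Assume that for every $n\in\mathbb{T}$ there exists $B_n<\infty$ such that $w_n(\mathbf{x}_n)\le B_n$ for all $\mathbf{x}_n\in\mathcal{S}_n$. Then for any $n\in\mathbb{T}$, any initial values $\mathbf{x}_{1:n}^{(0)}=(\mathbf{x}_1^{(0)},\ldots,\mathbf{x}_n^{(0)})\in\mathcal{S}_1\times\cdots\times\mathcal{S}_n$ and any $f_n\in B(E_n)$, $$\lim_{i\to\infty}\mathbb{E}_{\mathbf{x}_{1:n}^{(0)}}\left[f_n\left(\mathbf{X}_n^{(i)}\right)\right]=\pi_n(f_n).$$
   Context: Targets. $P\ge 1$ is an integer and $\mathbb{T}=\{1,\ldots,P\}$. $(E,\mathcal{F})$ is a measurable space; $E_1=E$, $\mathcal{F}_1=\mathcal{F}$, $E_n=E_{n-1}\times E$, $\mathcal{F}_n=\mathcal{F}_{n-1}\times\mathcal{F}$; write $\mathbf{x}_n=(x_1,\ldots,x_n)\in E_n$. Each $\pi_n$ is a probability measure on $(E_n,\mathcal{F}_n)$ with density $\pi_n(\mathbf{x}_n)=\gamma_n(\mathbf{x}_n)/Z_n$ with respect to a $\sigma$-finite measure $d\mathbf{x}_n$, where $d\mathbf{x}_n=d\mathbf{x}_{n-1}\times dx_n$, $\gamma_n:E_n\to\mathbb{R}^+$ and $Z_n\in(0,\infty)$ is the normalizing constant. Let $\mathcal{S}_n=\{\mathbf{x}_n\in E_n:\pi_n(\mathbf{x}_n)>0\}$. Proposals and weights. $q_1$ is a probability density on $E$ with respect to $dx_1$; for $n\ge 2$, $q_n(\mathbf{x}_{n-1},x_n)$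 is a probability density in $x_n$ with respect to $dx_n$ for each $\mathbf{x}_{n-1}\in E_{n-1}$. The weights are $w_1(\mathbf{x}_1)=\gamma_1(\mathbf{x}_1)/q_1(\mathbf{x}_1)$ and, for $n\ge2$, $w_n(\mathbf{x}_n)=\dfrac{\gamma_n(\mathbf{x}_n)}{\gamma_{n-1}(\mathbf{x}_{n-1})q_n(\mathbf{x}_{n-1},x_n)}$ (a ratio $a/0$ with $a>0$ is $+\infty$). For a measure $\mu$ on $E_{n-1}$, $(\mu\times q_n)(d\mathbf{x}_n)=\mu(d\mathbf{x}_{n-1})q_n(\mathbf{x}_{n-1},x_n)dx_n$. Algorithm (SIMCMC). Set $\mathbf{X}_n^{(0)}=\mathbf{x}_n^{(0)}\in\mathcal{S}_n$ for $n\in\mathbb{T}$. At each iteration $i\ge1$, process $n=1,2,\ldots,P$ in order: for $n=1$ sample $\mathbf{X}_1^{*(i)}\sim q_1$; for $n\ge2$ sample $\mathbf{X}_n^{*(i)}\sim\widehat{\pi}_{n-1}^{(i)}\times q_n$. With probability $1\wedge\frac{w_n(\mathbf{X}_n^{*(i)})}{w_n(\mathbf{X}_n^{(i-1)})}$ set $\mathbf{X}_n^{(i)}=\mathbf{X}_n^{*(i)}$, otherwise set $\mathbf{X}_n^{(i)}=\mathbf{X}_n^{(i-1)}$. All proposal and acceptance draws are made with fresh independent randomness given the past. Here $\widehat{\pi}_n^{(i)}=\frac{1}{i+1}\sum_{m=0}^{i}\delta_{\mathbf{X}_n^{(m)}}$ is the empirical measure. Notation. $\mathbb{E}_{\mathbf{x}_{1:n}^{(0)}}$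 is expectation for the algorithm initialized at $\mathbf{x}_{1:n}^{(0)}$. $\mu(f)=\int f\,d\mu$. $B(E_n)$ is the set of (measurable) $f_n:E_n\to\mathbb{R}$ with $\sup_{\mathbf{x}_n\in E_n}|f_n(\mathbf{x}_n)|\le1$. *)

theory Defs
  imports "HOL-Probability.Probability"
begin

text \<open>
  A point of \<open>E\<^sub>n\<close> is a function on \<open>{1..n}\<close> (undefined elsewhere), so that the
  truncation \<open>x\<^sub>1,\<dots>,x\<^sub>n\<^sub>-\<^sub>1\<close> of \<open>x\<close> is \<open>restrict x {1..n - 1}\<close>, and \<open>E\<^sub>0\<close> is a one-point space.
  Only the measurable structure of \<open>E\<close> matters. The reference measure \<open>dx\<^sub>n\<close> on the
  \<open>n\<close>-th coordinate is \<open>\<nu> n\<close>.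
\<close>

definition path_space :: "'a measure \<Rightarrow> nat \<Rightarrow> (nat \<Rightarrow> 'a) measure" where
  "path_space E n = PiM {1..n} (\<lambda>_. E)"

definition ref_measure :: "(nat \<Rightarrow> 'a measure) \<Rightarrow> nat \<Rightarrow> (nat \<Rightarrow> 'a) measure" where
  "ref_measure \<nu> n = PiM {1..n} \<nu>"

definition norm_const :: "(nat \<Rightarrow> 'a measure) \<Rightarrow> (nat \<Rightarrow> (nat \<Rightarrow> 'a) \<Rightarrow> real) \<Rightarrow> nat \<Rightarrow> real" where
  "norm_const \<nu> \<gamma> n = (\<integral>x. \<gamma> n x \<partial>ref_measure \<nu> n)"

definition target_density ::
  "(nat \<Rightarrow> 'a measure) \<Rightarrow> (nat \<Rightarrow> (nat \<Rightarrow> 'a) \<Rightarrow> real) \<Rightarrow> nat \<Rightarrow> (nat \<Rightarrow> 'a) \<Rightarrow> real" where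
  "target_density \<nu> \<gamma> n x = \<gamma> n x / norm_const \<nu> \<gamma> n"

definition target ::
  "(nat \<Rightarrow> 'a measure) \<Rightarrow> (nat \<Rightarrow> (nat \<Rightarrow> 'a) \<Rightarrow> real) \<Rightarrow> nat \<Rightarrow> (nat \<Rightarrow> 'a) measure" where
  "target \<nu> \<gamma> n = density (ref_measure \<nu> n) (\<lambda>x. ennreal (target_density \<nu> \<gamma> n x))"

definition target_support ::
  "'a measure \<Rightarrow> (nat \<Rightarrow> 'a measure) \<Rightarrow> (nat \<Rightarrow> (nat \<Rightarrow> 'a) \<Rightarrow> real) \<Rightarrow> nat \<Rightarrow> (nat \<Rightarrow> 'a) set" where
  "target_support E \<nu> \<gamma> n = {x \<in> space (path_space E n). target_density \<nu> \<gamma> n x > 0}"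

text \<open>
  \<open>q n x y\<close> is the proposal density \<open>q\<^sub>n(x,y)\<close>; the density \<open>q\<^sub>1\<close> on \<open>E\<close> is
  \<open>q 1 (\<lambda>_. undefined)\<close>, where \<open>\<lambda>_. undefined\<close> is the only point of \<open>E\<^sub>0\<close>.

  The weights live in \<open>[0,\<infinity>]\<close>; division on \<^typ>\<open>ennreal\<close> satisfies \<open>a / 0 = \<infinity>\<close> for
  \<open>a > 0\<close>, and \<open>0 / 0 = 0\<close>.
\<close>

definition weight ::
  "(nat \<Rightarrow> (nat \<Rightarrow> 'a) \<Rightarrow> real) \<Rightarrow> (nat \<Rightarrow> (nat \<Rightarrow> 'a) \<Rightarrow> 'a \<Rightarrow> real) \<Rightarrow> nat \<Rightarrow> (nat \<Rightarrow> 'a) \<Rightarrow> ennreal" where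
  "weight \<gamma> q n x =
     (if n = 1 then ennreal (\<gamma> 1 x) / ennreal (q 1 (\<lambda>_. undefined) (x 1))
      else ennreal (\<gamma> n x) /
        (ennreal (\<gamma> (n - 1) (restrict x {1..n - 1})) * ennreal (q n (restrict x {1..n - 1}) (x n))))"

text \<open>The measure \<open>\<mu> \<times> q\<^sub>n\<close> on \<open>E\<^sub>n\<close>, for \<open>\<mu>\<close> on \<open>E\<^sub>n\<^sub>-\<^sub>1\<close>.\<close>

definition extend_by ::
  "'a measure \<Rightarrow> (nat \<Rightarrow> 'a measure) \<Rightarrow> (nat \<Rightarrow> (nat \<Rightarrow> 'a) \<Rightarrow> 'a \<Rightarrow> real) \<Rightarrow> nat
    \<Rightarrow> (nat \<Rightarrow> 'a) measure \<Rightarrow> (nat \<Rightarrow> 'a) measure" where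
  "extend_by E \<nu> q n \<mu> =
     \<mu> \<bind> (\<lambda>x. distr (density (\<nu> n) (\<lambda>y. ennreal (q n x y))) (path_space E n) (\<lambda>y. x(n := y)))"

text \<open>
  A trajectory of the \<open>P\<close>-level algorithm maps \<open>(n, i)\<close> to \<open>X\<^sub>n\<close> at iteration \<open>i\<close>.
  Running the algorithm overwrites the entries one by one. Entries not yet
  reached still carry the initial value, but are never read.
\<close>

type_synonym 'a trajectory = "nat \<times> nat \<Rightarrow> nat \<Rightarrow> 'a"

definition trajectory_space :: "'a measure \<Rightarrow> nat \<Rightarrow> 'a trajectory measure" where
  "trajectory_space E P = PiM ({1..P} \<times> UNIV) (\<lambda>(n, i). path_space E n)"

definition initial_trajectory :: "nat \<Rightarrow> (nat \<Rightarrow> nat \<Rightarrow> 'a) \<Rightarrow> 'a trajectory" where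
  "initial_trajectory P x0 = (\<lambda>(n, i) \<in> {1..P} \<times> UNIV. x0 n)"

definition empirical_measure ::
  "'a measure \<Rightarrow> 'a trajectory \<Rightarrow> nat \<Rightarrow> nat \<Rightarrow> (nat \<Rightarrow> 'a) measure" where
  "empirical_measure E h n i =
     measure_of (space (path_space E n)) (sets (path_space E n))
       (\<lambda>A. (\<Sum>m\<le>i. emeasure (return (path_space E n) (h (n, m))) A) / of_nat (i + 1))"

definition proposal ::
  "'a measure \<Rightarrow> (nat \<Rightarrow> 'a measure) \<Rightarrow> (nat \<Rightarrow> (nat \<Rightarrow> 'a) \<Rightarrow> 'a \<Rightarrow> real)
    \<Rightarrow> 'a trajectory \<Rightarrow> nat \<Rightarrow> nat \<Rightarrow> (nat \<Rightarrow> 'a) measure" where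
  "proposal E \<nu> q h n i =
     (if n = 1 then
        distr (density (\<nu> 1) (\<lambda>y. ennreal (q 1 (\<lambda>_. undefined) y))) (path_space E 1)
          (\<lambda>y. (\<lambda>_. undefined)(1 := y))
      else extend_by E \<nu> q n (empirical_measure E h (n - 1) i))"

definition accept_prob ::
  "(nat \<Rightarrow> (nat \<Rightarrow> 'a) \<Rightarrow> real) \<Rightarrow> (nat \<Rightarrow> (nat \<Rightarrow> 'a) \<Rightarrow> 'a \<Rightarrow> real) \<Rightarrow> nat
    \<Rightarrow> (nat \<Rightarrow> 'a) \<Rightarrow> (nat \<Rightarrow> 'a) \<Rightarrow> real" where
  "accept_prob \<gamma> q n x y = enn2real (min 1 (weight \<gamma> q n y / weight \<gamma> q n x))"

definition update_level ::
  "'a measure \<Rightarrow> (nat \<Rightarrow> 'a measure) \<Rightarrow> (nat \<Rightarrow> (nat \<Rightarrow> 'a) \<Rightarrow> real)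
    \<Rightarrow> (nat \<Rightarrow> (nat \<Rightarrow> 'a) \<Rightarrow> 'a \<Rightarrow> real) \<Rightarrow> nat \<Rightarrow> nat \<Rightarrow> nat
    \<Rightarrow> 'a trajectory \<Rightarrow> 'a trajectory measure" where
  "update_level E \<nu> \<gamma> q P i n h =
     proposal E \<nu> q h n i \<bind> (\<lambda>y.
       measure_pmf (bernoulli_pmf (accept_prob \<gamma> q n (h (n, i - 1)) y)) \<bind> (\<lambda>accept.
         return (trajectory_space E P) (h((n, i) := (if accept then y else h (n, i - 1))))))"

text \<open>Iteration \<open>i\<close>, restricted to the levels \<open>1,\<dots>,k\<close>.\<close>

primrec update_levels ::
  "'a measure \<Rightarrow> (nat \<Rightarrow> 'a measure) \<Rightarrow> (nat \<Rightarrow> (nat \<Rightarrow> 'a) \<Rightarrow> real)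
    \<Rightarrow> (nat \<Rightarrow> (nat \<Rightarrow> 'a) \<Rightarrow> 'a \<Rightarrow> real) \<Rightarrow> nat \<Rightarrow> nat \<Rightarrow> nat
    \<Rightarrow> 'a trajectory \<Rightarrow> 'a trajectory measure" where
  "update_levels E \<nu> \<gamma> q P i 0 h = return (trajectory_space E P) h"
| "update_levels E \<nu> \<gamma> q P i (Suc k) h =
     update_levels E \<nu> \<gamma> q P i k h \<bind> update_level E \<nu> \<gamma> q P i (Suc k)"

text \<open>
  The joint law of all \<open>X\<^sub>n\<close> at the iterations \<open>0,\<dots>,i\<close>, for the algorithm
  started at \<open>x0\<close>.
\<close>

primrec simcmc ::
  "'a measure \<Rightarrow> (nat \<Rightarrow> 'a measure) \<Rightarrow> (nat \<Rightarrow> (nat \<Rightarrow> 'a) \<Rightarrow> real)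
    \<Rightarrow> (nat \<Rightarrow> (nat \<Rightarrow> 'a) \<Rightarrow> 'a \<Rightarrow> real) \<Rightarrow> nat \<Rightarrow> (nat \<Rightarrow> nat \<Rightarrow> 'a)
    \<Rightarrow> nat \<Rightarrow> 'a trajectory measure" where
  "simcmc E \<nu> \<gamma> q P x0 0 = return (trajectory_space E P) (initial_trajectory P x0)"
| "simcmc E \<nu> \<gamma> q P x0 (Suc i) =
     simcmc E \<nu> \<gamma> q P x0 i \<bind> update_levels E \<nu> \<gamma> q P (Suc i) P"

end

theory Submission
  imports Defs "HOL-Real_Asymp.Real_Asymp"
begin

text \<open>
  For a probability measure \<open>p\<close> on \<open>E\<^sub>n\<close> let \<open>K\<^sub>p\<close> be the independence Metropolis-Hastings kernel
  with proposal \<open>p\<close> and acceptance probability \<open>1 \<and> w\<^sub>n(y) / w\<^sub>n(x)\<close>. Given the past, \<open>X\<^sub>n\<close> moves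
  according to \<open>K\<^sub>p\<close> with the random proposal \<open>p = \<pi>\<^sub>n\<^sub>-\<^sub>1\<^sup>(\<^sup>i\<^sup>) \<times> q\<^sub>n\<close> built from an empirical measure;
  for \<open>\<eta> = \<pi>\<^sub>n\<^sub>-\<^sub>1 \<times> q\<^sub>n\<close> the kernel \<open>K = K\<^sub>\<eta>\<close> is reversible for \<open>\<pi>\<^sub>n\<close>, and the bound on the weights
  makes it a uniform contraction towards \<open>\<pi>\<^sub>n\<close>.

  Suppose that the empirical averages at level \<open>n - 1\<close> converge in \<open>L\<^sup>1\<close>. The kernel \<open>K\<^sub>p\<close> is affine
  in \<open>p\<close> and depends on the current state \<open>x\<close>, apart from the value \<open>g(x)\<close>, only through the number
  \<open>w\<^sub>n(x) \<in> (0, B\<^sub>n]\<close>, so a finite grid of test functions controls \<open>K\<^sub>p g - K g\<close> uniformly in \<open>x\<close>.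
  Hence \<open>E |K\<^sub>p g(X\<^sub>n) - K g(X\<^sub>n)| \<longlongrightarrow> 0\<close>. Two consequences: the averages of \<open>g - K g\<close> along the chain
  vanish in \<open>L\<^sup>1\<close>, by orthogonality of the martingale differences \<open>g(X\<^sub>n\<^sup>i\<^sup>+\<^sup>1) - K\<^sub>p g(X\<^sub>n\<^sup>i)\<close>, and
  telescoping \<open>f = \<Sum>\<^sub>j\<^sub><\<^sub>k (K\<^sup>j f - K\<^sup>j\<^sup>+\<^sup>1 f) + K\<^sup>k f\<close> carries the induction to level \<open>n\<close>; moreover
  \<open>E f(X\<^sub>n\<^sup>i\<^sup>+\<^sup>k) - E (K\<^sup>k f)(X\<^sub>n\<^sup>i) \<longlongrightarrow> 0\<close> for each fixed \<open>k\<close>, which gives convergence in law.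
\<close>

declare One_nat_def [simp del]

subsection \<open>Bounded functions and integration\<close>

text \<open>For \<open>M = path_space E n\<close> this is the class B(E_n) of the theorem. The bound
  is asked on \<open>space M\<close> only, because the type contains functions outside the path
  space.\<close>

definition unit_ball :: "'b measure \<Rightarrow> ('b \<Rightarrow> real) set" where
  "unit_ball M = {g \<in> borel_measurable M. \<forall>x\<in>space M. \<bar>g x\<bar> \<le> 1}"

lemma unit_ballI:
  "g \<in> borel_measurable M \<Longrightarrow> (\<And>x. x \<in> space M \<Longrightarrow> \<bar>g x\<bar> \<le> 1) \<Longrightarrow> g \<in> unit_ball M"
  by (auto simp: unit_ball_def)

lemma unit_ball_measurable[measurable_dest]: "g \<in> unit_ball M \<Longrightarrow> g \<in> borel_measurable M"
  by (auto simp: unit_ball_def)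

lemma unit_ball_bound: "g \<in> unit_ball M \<Longrightarrow> x \<in> space M \<Longrightarrow> \<bar>g x\<bar> \<le> 1"
  by (auto simp: unit_ball_def)

lemma unit_ball_cong: "sets M = sets N \<Longrightarrow> unit_ball M = unit_ball N"
  by (auto simp: unit_ball_def cong: measurable_cong_sets dest: sets_eq_imp_space_eq)

lemma unit_ball_mult: "f \<in> unit_ball M \<Longrightarrow> g \<in> unit_ball M \<Longrightarrow> (\<lambda>x. f x * g x) \<in> unit_ball M"
  by (rule unit_ballI) (auto dest: unit_ball_bound unit_ball_measurable simp: abs_mult intro!: mult_le_one)

lemma (in prob_space) integrable_bounded:
  fixes f :: "'a \<Rightarrow> real"
  assumes "f \<in> borel_measurable M" "\<And>x. x \<in> space M \<Longrightarrow> \<bar>f x\<bar> \<le> B"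
  shows "integrable M f"
  using assms by (intro integrable_const_bound[where B=B]) auto

lemma (in prob_space) abs_integral_le:
  fixes f :: "'a \<Rightarrow> real"
  assumes "f \<in> borel_measurable M" "\<And>x. x \<in> space M \<Longrightarrow> \<bar>f x\<bar> \<le> B"
  shows "\<bar>\<integral>x. f x \<partial>M\<bar> \<le> B"
proof -
  have i: "integrable M f" using assms by (rule integrable_bounded)
  have "\<bar>\<integral>x. f x \<partial>M\<bar> \<le> (\<integral>x. \<bar>f x\<bar> \<partial>M)" by (rule integral_abs_bound)
  also have "\<dots> \<le> (\<integral>x. B \<partial>M)"
    using i assms by (intro integral_mono) auto
  finally show ?thesis by (simp add: prob_space)
qed

lemma (in prob_space) integrable_unit_ball: "f \<in> unit_ball M \<Longrightarrow> integrable M f"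
  by (rule integrable_bounded[where B=1]) (auto simp: unit_ball_def)

lemma integral_bind_prob:
  fixes f :: "'b \<Rightarrow> real"
  assumes M: "M \<in> space (prob_algebra L)" and N: "N \<in> L \<rightarrow>\<^sub>M prob_algebra K"
    and f: "f \<in> borel_measurable K" "\<And>x. x \<in> space K \<Longrightarrow> \<bar>f x\<bar> \<le> B"
  shows "(\<integral>y. f y \<partial>(M \<bind> N)) = (\<integral>x. (\<integral>y. f y \<partial>N x) \<partial>M)"
proof (rule integral_bind[where K=K and B=B and B'=1])
  have sM: "sets M = sets L" and pM: "prob_space M" using M by (auto simp: space_prob_algebra)
  have N': "N \<in> M \<rightarrow>\<^sub>M prob_algebra K" using N measurable_cong_sets[OF sM refl] by blast
  then show "N \<in> M \<rightarrow>\<^sub>M subprob_algebra K" by (rule measurable_prob_algebraD)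
  show "finite_measure M" using pM by (rule prob_space.finite_measure)
  show "AE x in M. emeasure (N x) (space (N x)) \<le> ennreal 1"
  proof (rule AE_I2)
    fix x assume "x \<in> space M"
    then have "prob_space (N x)" using measurable_space[OF N'] by (auto simp: space_prob_algebra)
    then show "emeasure (N x) (space (N x)) \<le> ennreal 1" by (simp add: prob_space.emeasure_space_1)
  qed
qed (use f in auto)

lemma integral_PiM_insert:
  fixes f :: "('i \<Rightarrow> 'a) \<Rightarrow> real"
  assumes sf: "\<And>j. j \<in> insert i I \<Longrightarrow> sigma_finite_measure (M j)"
    and I: "finite I" "i \<notin> I"
    and f: "integrable (PiM (insert i I) M) f"
  shows "integral\<^sup>L (PiM (insert i I) M) f = (\<integral>x. (\<integral>y. f (x(i := y)) \<partial>M i) \<partial>PiM I M)"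
proof -
  \<comment> \<open>\<open>product_sigma_finite\<close> asks for \<sigma>-finiteness at every index,
    whereas here it is known on \<open>insert i I\<close> only. Null measures elsewhere supply the
    rest and leave both products unchanged.\<close>
  define M' where "M' j = (if j \<in> insert i I then M j else null_measure (M i))" for j
  have "sigma_finite_measure (M' j)" for j
    unfolding M'_def
    by (cases "j \<in> insert i I") (auto simp: sf intro!: finite_measure.sigma_finite_measure finite_measureI)
  then interpret product_sigma_finite M' by (rule product_sigma_finite.intro)
  have 1: "PiM (insert i I) M = PiM (insert i I) M'" and 2: "PiM I M = PiM I M'"
    by (auto intro!: PiM_cong simp: M'_def)
  have 3: "M' i = M i" by (simp add: M'_def)
  show ?thesis
    using product_integral_insert[OF I, of f] f unfolding 1 2 3 by simp
qed

text \<open>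
  The convention \<open>\<gamma> 0 = 1\<close>, harmless since the algorithm never reads \<open>\<gamma> 0\<close>, turns level \<open>1\<close>
  into an instance of the general step, with a one-point space and target below it.
\<close>
locale simcmc_setup =
  fixes E :: "'a measure"
    and \<nu> :: "nat \<Rightarrow> 'a measure"
    and \<gamma> :: "nat \<Rightarrow> (nat \<Rightarrow> 'a) \<Rightarrow> real"
    and q :: "nat \<Rightarrow> (nat \<Rightarrow> 'a) \<Rightarrow> 'a \<Rightarrow> real"
    and P :: nat
    and x0 :: "nat \<Rightarrow> nat \<Rightarrow> 'a"
  assumes sf_nu: "\<And>k. k \<in> {1..P} \<Longrightarrow> sigma_finite_measure (\<nu> k)"
    and sets_nu: "\<And>k. k \<in> {1..P} \<Longrightarrow> sets (\<nu> k) = sets E"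
    and g_0: "\<gamma> 0 = (\<lambda>_. 1)"
    and g_nonneg: "\<And>k x. k \<in> {1..P} \<Longrightarrow> x \<in> space (path_space E k) \<Longrightarrow> \<gamma> k x \<ge> 0"
    and g_integrable: "\<And>k. k \<in> {1..P} \<Longrightarrow> integrable (ref_measure \<nu> k) (\<gamma> k)"
    and norm_const_pos: "\<And>k. k \<in> {1..P} \<Longrightarrow> norm_const \<nu> \<gamma> k > 0"
    and q_measurable: "\<And>k. k \<in> {1..P} \<Longrightarrow>
          (\<lambda>(x, y). q k x y) \<in> borel_measurable (path_space E (k - 1) \<Otimes>\<^sub>M E)"
    and q_nonneg: "\<And>k x y. k \<in> {1..P} \<Longrightarrow> x \<in> space (path_space E (k - 1)) \<Longrightarrow> y \<in> space E \<Longrightarrow> q k x y \<ge> 0"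
    and q_prob: "\<And>k x. k \<in> {1..P} \<Longrightarrow> x \<in> space (path_space E (k - 1)) \<Longrightarrow>
          (\<integral>\<^sup>+ y. ennreal (q k x y) \<partial>\<nu> k) = 1"
    and weight_bounded: "\<forall>k \<in> {1..P}. \<exists>B :: real. \<forall>x \<in> target_support E \<nu> \<gamma> k. weight \<gamma> q k x \<le> ennreal B"
    and x0_supp: "\<And>k. k \<in> {1..P} \<Longrightarrow> x0 k \<in> target_support E \<nu> \<gamma> k"
begin

abbreviation "S n \<equiv> path_space E n"
abbreviation "T \<equiv> trajectory_space E P"
abbreviation "supp n \<equiv> target_support E \<nu> \<gamma> n"
abbreviation "Z n \<equiv> norm_const \<nu> \<gamma> n"
abbreviation "tgt n \<equiv> target \<nu> \<gamma> n"

section \<open>Path spaces and reference measures\<close>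

lemma sets_ref: "n \<le> P \<Longrightarrow> sets (ref_measure \<nu> n) = sets (S n)"
  unfolding ref_measure_def path_space_def by (intro sets_PiM_cong) (auto simp: sets_nu)

lemma space_nu: "k \<in> {1..P} \<Longrightarrow> space (\<nu> k) = space E"
  using sets_nu by (rule sets_eq_imp_space_eq)

lemma space_ref: "n \<le> P \<Longrightarrow> space (ref_measure \<nu> n) = space (S n)"
  using sets_ref by (rule sets_eq_imp_space_eq)

lemma space_S_0: "space (S 0) = {\<lambda>_. undefined}"
  by (simp add: path_space_def space_PiM)

lemma ref_0: "ref_measure \<nu> 0 = count_space {\<lambda>_. undefined}"
  by (simp add: ref_measure_def PiM_empty)

lemma Z_0: "Z 0 = 1"
  by (simp add: norm_const_def ref_0 g_0)

lemma Z_pos: "n \<le> P \<Longrightarrow> Z n > 0"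
  using norm_const_pos[of n] Z_0 by (cases "n = 0") auto

lemma g_ge_0: "n \<le> P \<Longrightarrow> x \<in> space (S n) \<Longrightarrow> \<gamma> n x \<ge> 0"
  using g_nonneg[of n] g_0 by (cases "n = 0") auto

lemma g_int: "n \<le> P \<Longrightarrow> integrable (ref_measure \<nu> n) (\<gamma> n)"
  using g_integrable[of n] by (cases "n = 0") (auto simp: g_0 ref_0 integrable_count_space)

lemma g_meas[measurable]: "n \<le> P \<Longrightarrow> \<gamma> n \<in> borel_measurable (S n)"
  using g_int[of n] sets_ref[of n] by (metis borel_measurable_integrable measurable_cong_sets)

lemma insert_Icc: "n \<ge> 1 \<Longrightarrow> insert n {1..n - 1} = {1..n::nat}"
  by auto

lemma append_measurable:
  assumes "n \<ge> 1" shows "(\<lambda>(x, y). x(n := y)) \<in> S (n - 1) \<Otimes>\<^sub>M E \<rightarrow>\<^sub>M S n"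
  using measurable_add_dim[of n "{1..n - 1}" "\<lambda>_. E"]
  unfolding path_space_def insert_Icc[OF assms] .

lemma append_measurable'[measurable (raw)]:
  assumes "n \<ge> 1" "f \<in> M \<rightarrow>\<^sub>M S (n - 1)" "g \<in> M \<rightarrow>\<^sub>M E"
  shows "(\<lambda>w. (f w)(n := g w)) \<in> M \<rightarrow>\<^sub>M S n"
  using measurable_compose[OF measurable_Pair[OF assms(2,3)] append_measurable[OF assms(1)]]
  by simp

lemma append_space: "n \<ge> 1 \<Longrightarrow> x \<in> space (S (n - 1)) \<Longrightarrow> y \<in> space E \<Longrightarrow> x(n := y) \<in> space (S n)"
  using measurable_space[OF append_measurable, of n "(x, y)"] by (auto simp: space_pair_measure)

lemma restrict_measurable[measurable]: "(\<lambda>x. restrict x {1..n - 1}) \<in> S n \<rightarrow>\<^sub>M S (n - 1)"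
  unfolding path_space_def by (rule measurable_restrict_subset) auto

lemma last_measurable[measurable]: "n \<ge> 1 \<Longrightarrow> (\<lambda>x. x n) \<in> S n \<rightarrow>\<^sub>M E"
  unfolding path_space_def by (rule measurable_component_singleton) auto

lemma restrict_append: "n \<ge> 1 \<Longrightarrow> x \<in> space (S (n - 1)) \<Longrightarrow> restrict (x(n := y)) {1..n - 1} = x"
  by (auto simp: path_space_def space_PiM PiE_def extensional_def restrict_def fun_eq_iff)

lemma q_meas: "k \<in> {1..P} \<Longrightarrow> f \<in> M \<rightarrow>\<^sub>M S (k - 1) \<Longrightarrow> g \<in> M \<rightarrow>\<^sub>M E
    \<Longrightarrow> (\<lambda>w. q k (f w) (g w)) \<in> borel_measurable M"
  using measurable_compose[OF measurable_Pair q_measurable, of f M k g] by simp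

section \<open>Proposal kernels and target measures\<close>

definition kern :: "nat \<Rightarrow> (nat \<Rightarrow> 'a) \<Rightarrow> (nat \<Rightarrow> 'a) measure" where
  "kern n x = distr (density (\<nu> n) (\<lambda>y. ennreal (q n x y))) (S n) (\<lambda>y. x(n := y))"

lemma dens_kernel:
  assumes n: "n \<in> {1..P}"
  shows "(\<lambda>x. density (\<nu> n) (\<lambda>y. ennreal (q n x y))) \<in> S (n - 1) \<rightarrow>\<^sub>M prob_algebra E"
proof (rule measurable_prob_algebraI)
  interpret sigma_finite_measure "\<nu> n" using sf_nu[OF n] .
  note [measurable_cong] = sets_nu[OF n]
  have qm[measurable]: "(\<lambda>(x, y). q n x y) \<in> borel_measurable (S (n - 1) \<Otimes>\<^sub>M \<nu> n)"
    using q_measurable[OF n] by measurable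
  show pr: "prob_space (density (\<nu> n) (\<lambda>y. ennreal (q n x y)))" if x: "x \<in> space (S (n - 1))" for x
  proof (rule prob_spaceI)
    show "emeasure (density (\<nu> n) (\<lambda>y. ennreal (q n x y))) (space (density (\<nu> n) (\<lambda>y. ennreal (q n x y)))) = 1"
      using q_prob[OF n x] x by (subst emeasure_density) (auto cong: nn_integral_cong)
  qed
  show "(\<lambda>x. density (\<nu> n) (\<lambda>y. ennreal (q n x y))) \<in> S (n - 1) \<rightarrow>\<^sub>M subprob_algebra E"
  proof (rule measurable_subprob_algebra)
    show "subprob_space (density (\<nu> n) (\<lambda>y. ennreal (q n x y)))" if "x \<in> space (S (n - 1))" for x
      using pr[OF that] by (rule prob_space_imp_subprob_space)
    fix A assume A[measurable]: "A \<in> sets E"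
    show "(\<lambda>x. emeasure (density (\<nu> n) (\<lambda>y. ennreal (q n x y))) A) \<in> borel_measurable (S (n - 1))"
    proof (subst measurable_cong)
      show "emeasure (density (\<nu> n) (\<lambda>y. ennreal (q n x y))) A
          = (\<integral>\<^sup>+y. ennreal (q n x y) * indicator A y \<partial>\<nu> n)" if "x \<in> space (S (n - 1))" for x
        using that by (subst emeasure_density) auto
    qed measurable
  qed (simp add: sets_nu[OF n])
qed

lemma kern_measurable[measurable]:
  assumes n: "n \<in> {1..P}"
  shows "kern n \<in> S (n - 1) \<rightarrow>\<^sub>M prob_algebra (S n)"
  unfolding kern_def using append_measurable n
  by (intro measurable_distr_prob_space2[OF dens_kernel[OF n]]) auto

lemma kern_space: "n \<in> {1..P} \<Longrightarrow> x \<in> space (S (n - 1)) \<Longrightarrow> kern n x \<in> space (prob_algebra (S n))"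
  using measurable_space[OF kern_measurable] .

lemma integral_kern:
  fixes f :: "(nat \<Rightarrow> 'a) \<Rightarrow> real"
  assumes n: "n \<in> {1..P}" and x: "x \<in> space (S (n - 1))" and f[measurable]: "f \<in> borel_measurable (S n)"
  shows "(\<integral>y. f y \<partial>kern n x) = (\<integral>y. q n x y * f (x(n := y)) \<partial>\<nu> n)"
proof -
  note [measurable_cong] = sets_nu[OF n]
  have n1: "n \<ge> 1" using n by auto
  have [measurable]: "(\<lambda>y. x(n := y)) \<in> E \<rightarrow>\<^sub>M S n"
    using x n1 by measurable
  have [measurable]: "q n x \<in> borel_measurable E"
    using x q_meas[OF n, of "\<lambda>_. x" E "\<lambda>y. y"] by simp
  have "(\<integral>y. f y \<partial>kern n x) = (\<integral>y. f (x(n := y)) \<partial>density (\<nu> n) (\<lambda>y. ennreal (q n x y)))"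
    unfolding kern_def
    by (rule integral_distr) (simp_all cong: measurable_cong_sets add: sets_nu[OF n])
  also have "\<dots> = (\<integral>y. q n x y * f (x(n := y)) \<partial>\<nu> n)"
    using q_nonneg[OF n x] by (subst integral_density) (auto simp: space_nu[OF n] sets_nu[OF n] cong: measurable_cong_sets)
  finally show ?thesis .
qed

lemma tgt_density_int: "n \<le> P \<Longrightarrow> integrable (ref_measure \<nu> n) (target_density \<nu> \<gamma> n)"
  unfolding target_density_def using g_int by auto

lemma sets_tgt: "n \<le> P \<Longrightarrow> sets (tgt n) = sets (S n)"
  by (simp add: target_def sets_ref)

lemma target_density_nonneg: "n \<le> P \<Longrightarrow> x \<in> space (S n) \<Longrightarrow> target_density \<nu> \<gamma> n x \<ge> 0"
  using g_ge_0 Z_pos[of n] by (simp add: target_density_def)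

lemma prob_tgt: assumes n: "n \<le> P" shows "prob_space (tgt n)"
proof (rule prob_spaceI)
  have "(\<integral>\<^sup>+x. ennreal (target_density \<nu> \<gamma> n x) \<partial>ref_measure \<nu> n)
      = ennreal (\<integral>x. target_density \<nu> \<gamma> n x \<partial>ref_measure \<nu> n)"
    using tgt_density_int[OF n] target_density_nonneg[OF n]
    by (intro nn_integral_eq_integral) (auto simp: space_ref[OF n])
  also have "(\<integral>x. target_density \<nu> \<gamma> n x \<partial>ref_measure \<nu> n) = 1"
    unfolding target_density_def using Z_pos[OF n] by (simp add: norm_const_def)
  finally show "emeasure (tgt n) (space (tgt n)) = 1"
    unfolding target_def using tgt_density_int[OF n]
    by (subst emeasure_density) (auto cong: nn_integral_cong)
qed

lemma tgt_space: "n \<le> P \<Longrightarrow> tgt n \<in> space (prob_algebra (S n))"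
  by (simp add: space_prob_algebra prob_tgt sets_tgt)

lemma integral_tgt:
  fixes f :: "(nat \<Rightarrow> 'a) \<Rightarrow> real"
  assumes n: "n \<le> P" and f[measurable]: "f \<in> borel_measurable (S n)"
  shows "(\<integral>x. f x \<partial>tgt n) = (\<integral>x. \<gamma> n x / Z n * f x \<partial>ref_measure \<nu> n)"
proof -
  note [measurable_cong] = sets_ref[OF n]
  show ?thesis
    unfolding target_def using target_density_nonneg[OF n] tgt_density_int[OF n]
    by (subst integral_density) (auto simp: space_ref[OF n] target_density_def)
qed

section \<open>Weights as real numbers\<close>

definition wt :: "nat \<Rightarrow> (nat \<Rightarrow> 'a) \<Rightarrow> real" where
  "wt n x = enn2real (weight \<gamma> q n x)"

text \<open>With \<open>\<gamma> 0 = 1\<close> the denominator at level 1 becomes \<open>q 1\<close>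
  alone, so the general formula covers both branches of \<open>weight\<close>.\<close>

lemma weight_eq:
  assumes "n \<in> {1..P}"
  shows "weight \<gamma> q n x = ennreal (\<gamma> n x) /
     (ennreal (\<gamma> (n - 1) (restrict x {1..n - 1})) * ennreal (q n (restrict x {1..n - 1}) (x n)))"
proof (cases "n = 1")
  case True
  have "restrict x {1..n - 1} = (\<lambda>_. undefined)" using True by (auto simp: restrict_def)
  then show ?thesis using True by (simp add: weight_def g_0)
qed (simp add: weight_def)

lemma weight_measurable[measurable]:
  assumes n: "n \<in> {1..P}" shows "weight \<gamma> q n \<in> borel_measurable (S n)"
proof -
  have [measurable]: "(\<lambda>x. q n (restrict x {1..n - 1}) (x n)) \<in> borel_measurable (S n)"
    using n by (intro q_meas restrict_measurable last_measurable) auto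
  have [measurable]: "(\<lambda>x. \<gamma> (n - 1) (restrict x {1..n - 1})) \<in> borel_measurable (S n)"
    using n by (intro measurable_compose[OF restrict_measurable g_meas]) auto
  have [measurable]: "\<gamma> n \<in> borel_measurable (S n)" using n by (intro g_meas) auto
  have "(\<lambda>x. weight \<gamma> q n x) \<in> borel_measurable (S n)"
    unfolding weight_eq[OF n] by measurable
  then show ?thesis .
qed

lemma wt_measurable[measurable]: "n \<in> {1..P} \<Longrightarrow> wt n \<in> borel_measurable (S n)"
  unfolding wt_def by measurable

lemma supp_iff: "n \<in> {1..P} \<Longrightarrow> x \<in> supp n \<longleftrightarrow> x \<in> space (S n) \<and> \<gamma> n x > 0"
  using Z_pos[of n] by (auto simp: target_support_def target_density_def zero_less_divide_iff)

lemma wt_bound: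
  assumes n: "n \<in> {1..P}"
  obtains B where "B > 0" "\<And>x. x \<in> supp n \<Longrightarrow> weight \<gamma> q n x = ennreal (wt n x) \<and> 0 < wt n x \<and> wt n x \<le> B"
proof -
  from weight_bounded n obtain B where B: "\<And>x. x \<in> supp n \<Longrightarrow> weight \<gamma> q n x \<le> ennreal B" by blast
  show ?thesis
  \<comment> \<open>The given \<open>B\<close> may fail to be positive; the maximum with 1 makes it
    a legitimate divisor later.\<close>
  proof (rule that[of "max B 1"])
    fix x assume x: "x \<in> supp n"
    have fin: "weight \<gamma> q n x < top" using B[OF x] by (simp add: order_le_less_trans)
    \<comment> \<open>The numerator is positive and the denominator is a product of finite numbers,
      so the quotient cannot vanish; a zero denominator would give infinity, not 0.\<close>
    have "weight \<gamma> q n x \<noteq> 0"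
      using x unfolding weight_eq[OF n] supp_iff[OF n]
      by (auto simp: ennreal_divide_eq_0_iff ennreal_mult_eq_top_iff)
    then have "wt n x > 0" using fin by (simp add: wt_def enn2real_positive_iff zero_less_iff_neq_zero)
    moreover have "wt n x \<le> max B 1"
      using enn2real_mono[OF B[OF x]] by (auto simp: wt_def enn2real_ennreal max_def enn2real_eq_0_iff split: if_splits)
         (smt (verit) enn2real_ennreal ennreal_neg enn2real_0)+
    ultimately show "weight \<gamma> q n x = ennreal (wt n x) \<and> 0 < wt n x \<and> wt n x \<le> max B 1"
      using fin by (simp add: wt_def)
  qed simp
qed

lemma weight_off_supp: "n \<in> {1..P} \<Longrightarrow> x \<in> space (S n) \<Longrightarrow> x \<notin> supp n \<Longrightarrow> weight \<gamma> q n x = 0"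
  using g_ge_0[of n x] by (simp add: supp_iff weight_eq) 

text \<open>\<open>enn2real\<close> would turn infinity into 0, but infinity never occurs: on the
  support it is excluded by the assumed bound, and off the support \<open>\<gamma> n x = 0\<close>
  makes the weight 0, by \<open>0 / 0 = 0\<close> if need be.\<close>

lemma weight_wt:
  assumes n: "n \<in> {1..P}" and x: "x \<in> space (S n)" shows "weight \<gamma> q n x = ennreal (wt n x)"
  by (cases "x \<in> supp n") (use wt_bound[OF n] weight_off_supp[OF n x] in \<open>auto simp: wt_def\<close>)

lemma wt_nonneg: "0 \<le> wt n x" by (simp add: wt_def)

lemma wt_off_supp: "n \<in> {1..P} \<Longrightarrow> x \<in> space (S n) \<Longrightarrow> x \<notin> supp n \<Longrightarrow> wt n x = 0"
  using weight_off_supp by (simp add: wt_def)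

text \<open>The defining quotient of the weight with its denominator cleared. This is legitimate
  even where the denominator vanishes: a positive numerator would then give an infinite weight,
  against the bound, so both sides are 0. In this way the bound on the weights yields the absolute
  continuity of pi_n with respect to pi_(n-1) x q_n.\<close>

lemma wt_append:
  assumes n: "n \<in> {1..P}" and x: "x \<in> space (S (n - 1))" and y: "y \<in> space E"
  shows "\<gamma> (n - 1) x * q n x y * wt n (x(n := y)) = \<gamma> n (x(n := y))"
proof (cases "x(n := y) \<in> supp n")
  case True
  have w1: "weight \<gamma> q n (x(n := y)) = ennreal (wt n (x(n := y)))"
    using wt_bound[OF n] True by metis
  have n1: "n \<ge> 1" using n by auto
  have g: "\<gamma> (n - 1) x \<ge> 0" "q n x y \<ge> 0" using n x y by (auto intro: g_ge_0 q_nonneg)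
  have w3: "weight \<gamma> q n (x(n := y)) = ennreal (\<gamma> n (x(n := y))) / ennreal (\<gamma> (n - 1) x * q n x y)"
    unfolding weight_eq[OF n] restrict_append[OF n1 x] using g by (simp add: ennreal_mult)
  have nz: "\<gamma> (n - 1) x * q n x y \<noteq> 0"
  proof
    assume "\<gamma> (n - 1) x * q n x y = 0"
    then have "ennreal (\<gamma> (n - 1) x * q n x y) = 0" by (metis ennreal_0)
    then have "weight \<gamma> q n (x(n := y)) = top"
      unfolding w3 using True by (simp add: supp_iff[OF n] ennreal_divide_zero)
    with w1 show False by simp
  qed
  have gp: "\<gamma> n (x(n := y)) > 0" using True by (simp add: supp_iff[OF n])
  have p: "\<gamma> (n - 1) x * q n x y > 0" using nz g by (simp add: less_le)
  have "ennreal (wt n (x(n := y))) = ennreal (\<gamma> n (x(n := y)) / (\<gamma> (n - 1) x * q n x y))"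
    using w1 w3 gp p by (simp add: divide_ennreal)
  then have "wt n (x(n := y)) = \<gamma> n (x(n := y)) / (\<gamma> (n - 1) x * q n x y)"
    using gp p by (subst (asm) ennreal_inj) (auto simp: wt_nonneg)
  then show ?thesis using nz by simp
next
  case False
  have "x(n := y) \<in> space (S n)" using n x y by (intro append_space) auto
  with False show ?thesis using wt_off_supp[OF n] g_ge_0[of n "x(n := y)"] n by (auto simp: supp_iff)
qed

end

text \<open>Pushing \<open>p w\<close> forward along \<open>Pair w\<close> turns the integrand into
  one fixed function on the product space, so that only the measure depends on
  \<open>w\<close>.\<close>

lemma measurable_integral_kernel:
  fixes F :: "'w \<Rightarrow> 'b \<Rightarrow> real"
  assumes p: "p \<in> M \<rightarrow>\<^sub>M prob_algebra N"
    and F: "(\<lambda>(w, y). F w y) \<in> borel_measurable (M \<Otimes>\<^sub>M N)"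
  shows "(\<lambda>w. \<integral>y. F w y \<partial>p w) \<in> borel_measurable M"
proof -
  have [measurable]: "(\<lambda>w. distr (p w) (M \<Otimes>\<^sub>M N) (Pair w)) \<in> M \<rightarrow>\<^sub>M subprob_algebra (M \<Otimes>\<^sub>M N)"
    by (rule measurable_distr2[OF _ measurable_prob_algebraD[OF p]]) simp
  have "(\<lambda>w. \<integral>z. (case z of (w, y) \<Rightarrow> F w y) \<partial>distr (p w) (M \<Otimes>\<^sub>M N) (Pair w)) \<in> borel_measurable M"
    using integral_measurable_subprob_algebra[OF F] by measurable
  also have "?this \<longleftrightarrow> ?thesis"
  proof (rule measurable_cong)
    fix w assume w: "w \<in> space M"
    then have s: "sets (p w) = sets N" using measurable_space[OF p] by (auto simp: space_prob_algebra)
    have "Pair w \<in> p w \<rightarrow>\<^sub>M M \<Otimes>\<^sub>M N" using w by (simp cong: measurable_cong_sets add: s)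
    from integral_distr[OF this F]
    show "(\<integral>z. (case z of (w, y) \<Rightarrow> F w y) \<partial>distr (p w) (M \<Otimes>\<^sub>M N) (Pair w)) = (\<integral>y. F w y \<partial>p w)"
      by simp
  qed
  finally show ?thesis .
qed

context simcmc_setup
begin

subsection \<open>The limiting Metropolis-Hastings kernel\<close>

text \<open>The limit of the proposals, pi_(n-1) x q_n. At level 1 it is the law of a draw from
  \<open>q 1\<close>, since \<open>tgt 0\<close> is a point mass.\<close>

definition eta :: "nat \<Rightarrow> (nat \<Rightarrow> 'a) measure" where
  "eta n = tgt (n - 1) \<bind> kern n"

lemma eta_space: assumes n: "n \<in> {1..P}" shows "eta n \<in> space (prob_algebra (S n))"
proof -
  have t: "tgt (n - 1) \<in> space (prob_algebra (S (n - 1)))" using n by (intro tgt_space) auto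
  show ?thesis
    unfolding eta_def
    using prob_space_bind'[OF t kern_measurable[OF n]] sets_bind'[OF t kern_measurable[OF n]]
    by (simp add: space_prob_algebra)
qed

lemma sets_eta[measurable_cong]: "n \<in> {1..P} \<Longrightarrow> sets (eta n) = sets (S n)"
  and prob_eta: "n \<in> {1..P} \<Longrightarrow> prob_space (eta n)"
  using eta_space by (auto simp: space_prob_algebra)

lemma space_eta: "n \<in> {1..P} \<Longrightarrow> space (eta n) = space (S n)"
  using sets_eta by (rule sets_eq_imp_space_eq)

lemma integral_eta:
  fixes f :: "(nat \<Rightarrow> 'a) \<Rightarrow> real"
  assumes n: "n \<in> {1..P}" and f: "f \<in> borel_measurable (S n)" "\<And>x. x \<in> space (S n) \<Longrightarrow> \<bar>f x\<bar> \<le> C"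
  shows "(\<integral>y. f y \<partial>eta n) = (\<integral>x. (\<integral>y. f y \<partial>kern n x) \<partial>tgt (n - 1))"
  unfolding eta_def
  by (rule integral_bind_prob[OF tgt_space kern_measurable[OF n] f]) (use n in auto)

lemma integral_kern_measurable:
  fixes f :: "(nat \<Rightarrow> 'a) \<Rightarrow> real"
  assumes n: "n \<in> {1..P}" and f: "f \<in> borel_measurable (S n)"
  shows "(\<lambda>x. \<integral>y. f y \<partial>kern n x) \<in> borel_measurable (S (n - 1))"
  using measurable_compose[OF measurable_prob_algebraD[OF kern_measurable[OF n]] integral_measurable_subprob_algebra[OF f]] .

lemma integral_kern_unit_ball:
  assumes n: "n \<in> {1..P}" and f: "f \<in> unit_ball (S n)"
  shows "(\<lambda>x. \<integral>y. f y \<partial>kern n x) \<in> unit_ball (S (n - 1))"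
proof (rule unit_ballI)
  show "(\<lambda>x. \<integral>y. f y \<partial>kern n x) \<in> borel_measurable (S (n - 1))"
    using f by (intro integral_kern_measurable[OF n]) auto
  fix x assume x: "x \<in> space (S (n - 1))"
  have k: "prob_space (kern n x)" "sets (kern n x) = sets (S n)"
    using kern_space[OF n x] by (auto simp: space_prob_algebra)
  have "f \<in> unit_ball (kern n x)" using f unit_ball_cong[OF k(2)] by simp
  then show "\<bar>\<integral>y. f y \<partial>kern n x\<bar> \<le> 1"
    by (intro prob_space.abs_integral_le[OF k(1)]) (auto dest: unit_ball_bound)
qed

lemma wt_bound_all:
  assumes n: "n \<in> {1..P}"
  shows "\<exists>B>0. \<forall>x\<in>space (S n). wt n x \<le> B"
proof (rule wt_bound[OF n])
  fix B :: real
  assume "B > 0" and B: "\<And>x. x \<in> supp n \<Longrightarrow> weight \<gamma> q n x = ennreal (wt n x) \<and> 0 < wt n x \<and> wt n x \<le> B"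
  have "wt n x \<le> B" if "x \<in> space (S n)" for x
    using B[of x] wt_off_supp[OF n that] \<open>B > 0\<close> by (cases "x \<in> supp n") auto
  with \<open>B > 0\<close> show ?thesis by blast
qed

lemma wt_pos: "n \<in> {1..P} \<Longrightarrow> x \<in> supp n \<Longrightarrow> wt n x > 0"
  using wt_bound[of n] by metis

lemma supp_space: "x \<in> supp n \<Longrightarrow> x \<in> space (S n)"
  by (simp add: target_support_def)

text \<open>Up to the factor \<open>Z n / Z (n - 1)\<close>, \<open>wt n\<close> is the density of
  \<open>tgt n\<close> with respect to \<open>eta n\<close>. By \<open>wt_append\<close> the weight
  cancels the density of \<open>eta n\<close> and leaves \<open>\<gamma> n\<close>; Fubini then
  joins the last coordinate to the first \<open>n - 1\<close>.\<close>

lemma integral_eta_wt: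
  fixes f :: "(nat \<Rightarrow> 'a) \<Rightarrow> real"
  assumes n: "n \<in> {1..P}" and f[measurable]: "f \<in> borel_measurable (S n)"
    and bf: "\<And>x. x \<in> space (S n) \<Longrightarrow> \<bar>f x\<bar> \<le> C"
  shows "(\<integral>y. wt n y * f y \<partial>eta n) = Z n / Z (n - 1) * (\<integral>y. f y \<partial>tgt n)"
proof -
  have n1: "n - 1 \<le> P" "n \<le> P" "n \<ge> 1" using n by auto
  have [measurable]: "wt n \<in> borel_measurable (S n)" using n by (rule wt_measurable)
  obtain B where B: "B > 0" "\<forall>x\<in>space (S n). wt n x \<le> B"
    using wt_bound_all[OF n] by blast
  note B = B(1) bspec[OF B(2)]
  have fm: "(\<lambda>y. wt n y * f y) \<in> borel_measurable (S n)" by measurable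
  have I: "insert n {1..n - 1} = {1..n}" using insert_Icc n1 by blast
  have int: "integrable (ref_measure \<nu> n) (\<lambda>z. \<gamma> n z * f z)"
  proof (rule Bochner_Integration.integrable_bound[OF integrable_mult_right[OF g_int[OF n1(2)], of C]])
    show "(\<lambda>z. \<gamma> n z * f z) \<in> borel_measurable (ref_measure \<nu> n)"
      using g_int[OF n1(2)] f by (auto cong: measurable_cong_sets simp: sets_ref[OF n1(2)])
    show "AE z in ref_measure \<nu> n. norm (\<gamma> n z * f z) \<le> norm (C * \<gamma> n z)"
    proof (rule AE_I2)
      fix z assume "z \<in> space (ref_measure \<nu> n)"
      then have z: "z \<in> space (S n)" by (simp add: space_ref[OF n1(2)])
      then have "\<bar>f z\<bar> \<le> \<bar>C\<bar>" using bf[OF z] by linarith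
      then show "norm (\<gamma> n z * f z) \<le> norm (C * \<gamma> n z)"
        by (simp add: abs_mult mult.commute mult_right_mono)
    qed
  qed
  have "(\<integral>y. wt n y * f y \<partial>eta n) = (\<integral>x. (\<integral>y. wt n y * f y \<partial>kern n x) \<partial>tgt (n - 1))"
  proof (rule integral_eta[OF n fm])
    fix x assume x: "x \<in> space (S n)"
    show "\<bar>wt n x * f x\<bar> \<le> B * C"
      using B(2)[OF x] bf[OF x] wt_nonneg[of n x] B(1) by (auto simp: abs_mult intro!: mult_mono)
  qed
  also have "\<dots> = (\<integral>x. \<gamma> (n - 1) x / Z (n - 1) * (\<integral>y. wt n y * f y \<partial>kern n x) \<partial>ref_measure \<nu> (n - 1))"
    by (rule integral_tgt[OF n1(1) integral_kern_measurable[OF n fm]])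
  also have "\<dots> = (\<integral>x. (\<integral>y. \<gamma> n (x(n := y)) * f (x(n := y)) \<partial>\<nu> n) / Z (n - 1) \<partial>ref_measure \<nu> (n - 1))"
  proof (rule Bochner_Integration.integral_cong[OF refl])
    fix x assume "x \<in> space (ref_measure \<nu> (n - 1))"
    then have x: "x \<in> space (S (n - 1))" by (simp add: space_ref[OF n1(1)])
    have "\<gamma> (n - 1) x * (\<integral>y. wt n y * f y \<partial>kern n x)
        = (\<integral>y. \<gamma> (n - 1) x * (q n x y * (wt n (x(n := y)) * f (x(n := y)))) \<partial>\<nu> n)"
      by (simp add: integral_kern[OF n x fm])
    also have "\<dots> = (\<integral>y. \<gamma> n (x(n := y)) * f (x(n := y)) \<partial>\<nu> n)"
    proof (rule Bochner_Integration.integral_cong[OF refl])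
      fix y assume "y \<in> space (\<nu> n)"
      then show "\<gamma> (n - 1) x * (q n x y * (wt n (x(n := y)) * f (x(n := y)))) = \<gamma> n (x(n := y)) * f (x(n := y))"
        using wt_append[OF n x, of y] by (simp add: space_nu[OF n] mult.assoc[symmetric])
    qed
    finally show "\<gamma> (n - 1) x / Z (n - 1) * (\<integral>y. wt n y * f y \<partial>kern n x)
        = (\<integral>y. \<gamma> n (x(n := y)) * f (x(n := y)) \<partial>\<nu> n) / Z (n - 1)" by simp
  qed
  also have "\<dots> = (\<integral>z. \<gamma> n z * f z \<partial>ref_measure \<nu> n) / Z (n - 1)"
    using integral_PiM_insert[of n "{1..n - 1}" \<nu> "\<lambda>z. \<gamma> n z * f z"] int n n1
    unfolding ref_measure_def I by (auto simp: sf_nu)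
  also have "(\<integral>z. \<gamma> n z * f z \<partial>ref_measure \<nu> n) = Z n * (\<integral>y. f y \<partial>tgt n)"
    using Z_pos[OF n1(2)] by (simp add: integral_tgt[OF n1(2) f])
  finally show ?thesis by simp
qed

section \<open>Acceptance probability and Metropolis-Hastings operator\<close>

abbreviation acc :: "nat \<Rightarrow> (nat \<Rightarrow> 'a) \<Rightarrow> (nat \<Rightarrow> 'a) \<Rightarrow> real" where
  "acc n \<equiv> accept_prob \<gamma> q n"

lemma acc_bounds: "0 \<le> acc n x y" "acc n x y \<le> 1"
  unfolding accept_prob_def by (auto intro!: enn2real_leI)

lemma acc_measurable[measurable (raw)]:
  assumes "n \<in> {1..P}" "f \<in> M \<rightarrow>\<^sub>M S n" "g \<in> M \<rightarrow>\<^sub>M S n"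
  shows "(\<lambda>w. acc n (f w) (g w)) \<in> borel_measurable M"
proof -
  note [measurable] = measurable_compose[OF assms(2) weight_measurable[OF assms(1)]]
    measurable_compose[OF assms(3) weight_measurable[OF assms(1)]]
  show ?thesis unfolding accept_prob_def by measurable
qed

lemma acc_eq:
  assumes n: "n \<in> {1..P}" and x: "x \<in> supp n" and y: "y \<in> space (S n)"
  shows "acc n x y = min 1 (wt n y / wt n x)"
proof -
  have "weight \<gamma> q n y / weight \<gamma> q n x = ennreal (wt n y / wt n x)"
    using weight_wt[OF n y] weight_wt[OF n supp_space[OF x]] wt_pos[OF n x] wt_nonneg[of n y]
    by (simp add: divide_ennreal)
  then have "min 1 (weight \<gamma> q n y / weight \<gamma> q n x) = ennreal (min 1 (wt n y / wt n x))"
    using wt_pos[OF n x] wt_nonneg[of n y] by (simp add: min_def ennreal_1[symmetric] ennreal_le_iff del: ennreal_1)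
  then show ?thesis
    unfolding accept_prob_def using wt_nonneg[of n y] wt_nonneg[of n x] by simp
qed

text \<open>The Metropolis-Hastings kernel with independent proposal \<open>p\<close>, applied to
  \<open>g\<close>: a rejected move keeps \<open>g x\<close>, so only the accepted increment is
  integrated. No separate rejection mass has to be carried, and the dependence on \<open>p\<close>
  is visibly affine.\<close>

definition mh :: "nat \<Rightarrow> (nat \<Rightarrow> 'a) measure \<Rightarrow> ((nat \<Rightarrow> 'a) \<Rightarrow> real) \<Rightarrow> (nat \<Rightarrow> 'a) \<Rightarrow> real" where
  "mh n p g x = g x + (\<integral>y. acc n x y * (g y - g x) \<partial>p)"

lemma mh_measurable:
  assumes n: "n \<in> {1..P}" and p: "p \<in> M \<rightarrow>\<^sub>M prob_algebra (S n)" and f[measurable]: "f \<in> M \<rightarrow>\<^sub>M S n"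
    and g[measurable]: "g \<in> borel_measurable (S n)"
  shows "(\<lambda>w. mh n (p w) g (f w)) \<in> borel_measurable M"
proof -
  have "(\<lambda>(w, y). acc n (f w) y * (g y - g (f w))) \<in> borel_measurable (M \<Otimes>\<^sub>M S n)"
    using n by measurable
  from measurable_integral_kernel[OF p this] show ?thesis
    unfolding mh_def by measurable
qed

lemma mh_bound:
  assumes n: "n \<in> {1..P}" and p: "p \<in> space (prob_algebra (S n))" and g: "g \<in> unit_ball (S n)"
    and x: "x \<in> space (S n)"
  shows "\<bar>mh n p g x\<bar> \<le> 1"
proof -
  have [measurable_cong]: "sets p = sets (S n)" and "prob_space p" using p by (auto simp: space_prob_algebra)
  interpret prob_space p by fact
  have sp: "space p = space (S n)" by (rule sets_eq_imp_space_eq) fact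
  have [measurable]: "g \<in> borel_measurable (S n)" using g by auto
  have [measurable]: "(\<lambda>y. acc n x y) \<in> borel_measurable (S n)" using n x by measurable
  have i1: "integrable p (acc n x)"
    using acc_bounds by (intro integrable_bounded[where B=1]) (auto simp: abs_le_iff intro: order_trans[of _ 0])
  have b: "\<bar>acc n x y * g y\<bar> \<le> acc n x y" if "y \<in> space (S n)" for y
    using acc_bounds[of n x y] unit_ball_bound[OF g that] by (simp add: abs_mult mult_left_le)
  have i2: "integrable p (\<lambda>y. acc n x y * g y)"
    using b i1 by (intro Bochner_Integration.integrable_bound[OF i1]) (auto simp: sp intro!: AE_I2 order_trans[OF b])
  \<comment> \<open>Rearranged as rejection part plus accepted part; the two parts are bounded by
    masses that add up to 1.\<close>
  have "mh n p g x = g x * (1 - (\<integral>y. acc n x y \<partial>p)) + (\<integral>y. acc n x y * g y \<partial>p)"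
    unfolding mh_def right_diff_distrib using i1 i2 by (simp add: algebra_simps)
  moreover have "\<bar>\<integral>y. acc n x y * g y \<partial>p\<bar> \<le> (\<integral>y. acc n x y \<partial>p)"
    by (rule order_trans[OF integral_abs_bound integral_mono]) (use i1 i2 b in \<open>auto simp: sp\<close>)
  moreover have "(\<integral>y. acc n x y \<partial>p) \<le> 1"
    using i1 acc_bounds by (intro integral_le_const) auto
  then have "\<bar>g x * (1 - (\<integral>y. acc n x y \<partial>p))\<bar> \<le> 1 - (\<integral>y. acc n x y \<partial>p)"
    using unit_ball_bound[OF g x] by (simp add: abs_mult mult_left_le_one_le)
  ultimately show ?thesis by linarith
qed

lemma mh_unit_ball:
  assumes n: "n \<in> {1..P}" and p: "p \<in> space (prob_algebra (S n))" and g: "g \<in> unit_ball (S n)"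
  shows "mh n p g \<in> unit_ball (S n)"
  using mh_measurable[OF n, of "\<lambda>_. p" "S n" "\<lambda>x. x" g] p g
  by (intro unit_ballI mh_bound[OF assms]) auto

abbreviation "K n \<equiv> mh n (eta n)"

lemma K_unit_ball: "n \<in> {1..P} \<Longrightarrow> g \<in> unit_ball (S n) \<Longrightarrow> K n g \<in> unit_ball (S n)"
  by (rule mh_unit_ball[OF _ eta_space])

text \<open>Reversibility. Weighting by \<open>wt n x\<close> passes from \<open>tgt n\<close> to
  \<open>eta n\<close>, and \<open>wt n x * acc n x y = min (wt n x) (wt n y)\<close> is symmetric;
  multiplied by \<open>g y - g x\<close> it becomes antisymmetric and integrates to 0 over the
  product of \<open>eta n\<close> with itself.\<close>

lemma target_invariant:
  assumes n: "n \<in> {1..P}" and g: "g \<in> unit_ball (S n)"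
  shows "(\<integral>x. K n g x \<partial>tgt n) = (\<integral>x. g x \<partial>tgt n)"
proof -
  have nP: "n \<le> P" "n - 1 \<le> P" using n by auto
  interpret tp: prob_space "tgt n" using prob_tgt nP(1) .
  interpret ep: prob_space "eta n" using prob_eta n .
  interpret pair_sigma_finite "eta n" "eta n" by unfold_locales
  interpret pp: pair_prob_space "eta n" "eta n" by unfold_locales
  note sp = space_eta[OF n]
  note [measurable_cong] = sets_eta[OF n] sets_tgt[OF nP(1)]
  have [measurable]: "wt n \<in> borel_measurable (S n)" using n by (rule wt_measurable)
  have [measurable]: "g \<in> borel_measurable (S n)" using g by auto
  obtain B where B: "B > 0" "\<forall>x\<in>space (S n). wt n x \<le> B"
    using wt_bound_all[OF n] by blast
  note B = B(1) bspec[OF B(2)]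
  define F where "F x y = min (wt n x) (wt n y) * (g y - g x)" for x y
  have Kg: "K n g \<in> unit_ball (S n)" using K_unit_ball[OF n g] .
  then have [measurable]: "K n g \<in> borel_measurable (S n)" by auto
  have gt: "g \<in> unit_ball (tgt n)" "K n g \<in> unit_ball (tgt n)"
    using g Kg unit_ball_cong[OF sets_tgt[OF nP(1)]] by auto
  have Fb: "\<bar>F x y\<bar> \<le> B * 2" if "x \<in> space (S n)" "y \<in> space (S n)" for x y
    unfolding F_def abs_mult
    using B(2)[OF that(1)] B(1) wt_nonneg[of n x] wt_nonneg[of n y]
      unit_ball_bound[OF g that(1)] unit_ball_bound[OF g that(2)]
    by (intro mult_mono) auto
  have iF: "integrable (eta n \<Otimes>\<^sub>M eta n) (\<lambda>(x, y). F x y)"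
  proof (rule pp.integrable_bounded[where B="B * 2"])
    show "(\<lambda>(x, y). F x y) \<in> borel_measurable (eta n \<Otimes>\<^sub>M eta n)" unfolding F_def by measurable
    show "\<bar>case z of (x, y) \<Rightarrow> F x y\<bar> \<le> B * 2" if "z \<in> space (eta n \<Otimes>\<^sub>M eta n)" for z
      using that Fb by (cases z) (simp add: space_pair_measure sp)
  qed
  have "(\<integral>x. (\<integral>y. F x y \<partial>eta n) \<partial>eta n) = (\<integral>y. (\<integral>x. F x y \<partial>eta n) \<partial>eta n)"
    by (rule Fubini_integral[OF iF, symmetric])
  also have "\<dots> = - (\<integral>y. (\<integral>x. F y x \<partial>eta n) \<partial>eta n)"
    unfolding Bochner_Integration.integral_minus[symmetric] by (simp add: F_def min.commute right_diff_distrib)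
  finally have F0: "(\<integral>x. (\<integral>y. F x y \<partial>eta n) \<partial>eta n) = 0" by simp
  have "Z n / Z (n - 1) * (\<integral>x. K n g x - g x \<partial>tgt n) = (\<integral>x. wt n x * (K n g x - g x) \<partial>eta n)"
  proof (rule integral_eta_wt[OF n, symmetric])
    fix x assume x: "x \<in> space (S n)"
    show "\<bar>K n g x - g x\<bar> \<le> 2" using unit_ball_bound[OF g x] unit_ball_bound[OF Kg x] by linarith
  qed measurable
  also have "\<dots> = (\<integral>x. (\<integral>y. F x y \<partial>eta n) \<partial>eta n)"
  proof (rule Bochner_Integration.integral_cong[OF refl])
    fix x assume "x \<in> space (eta n)"
    then have x: "x \<in> space (S n)" by (simp add: sp)
    have "wt n x * (K n g x - g x) = (\<integral>y. wt n x * (acc n x y * (g y - g x)) \<partial>eta n)"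
      by (simp add: mh_def)
    also have "\<dots> = (\<integral>y. F x y \<partial>eta n)"
    proof (rule Bochner_Integration.integral_cong[OF refl])
      fix y assume "y \<in> space (eta n)"
      then have y: "y \<in> space (S n)" by (simp add: sp)
      show "wt n x * (acc n x y * (g y - g x)) = F x y"
      proof (cases "x \<in> supp n")
        case True
        with wt_pos[OF n True] show ?thesis
          by (simp add: acc_eq[OF n True y] F_def min_def divide_simps)
      next
        \<comment> \<open>Off the support \<open>wt n x = 0\<close>, so both sides vanish whatever
          value \<open>acc\<close> takes there.\<close>
        case False
        then show ?thesis using wt_off_supp[OF n x] wt_nonneg[of n y] by (simp add: F_def)
      qed
    qed
    finally show "wt n x * (K n g x - g x) = (\<integral>y. F x y \<partial>eta n)" .
  qed
  finally have "(\<integral>x. K n g x - g x \<partial>tgt n) = 0"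
    using F0 Z_pos[OF nP(1)] Z_pos[OF nP(2)] by simp
  then show ?thesis
    using tp.integrable_unit_ball[OF gt(1)] tp.integrable_unit_ball[OF gt(2)] by simp
qed

text \<open>A Doeblin minorization. Since \<open>wt n x \<le> B\<close>, a proposal \<open>y\<close>
  is accepted with probability at least \<open>wt n y / B\<close>, and this part of the move is
  \<open>\<rho>\<close> times \<open>tgt n\<close>, independently of \<open>x\<close>. It
  annihilates centred functions, and the remaining mass \<open>1 - \<rho>\<close> is the contraction
  factor. \<open>M\<close> is a bound on the support only, because that is where the chain
  lives.\<close>

lemma K_contraction:
  assumes n: "n \<in> {1..P}"
  obtains r where "0 \<le> r" "r < 1"
    "\<forall>g\<in>unit_ball (S n). \<forall>M. (\<forall>x\<in>supp n. \<bar>g x - (\<integral>x. g x \<partial>tgt n)\<bar> \<le> M)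
      \<longrightarrow> (\<forall>x\<in>supp n. \<bar>K n g x - (\<integral>x. g x \<partial>tgt n)\<bar> \<le> r * M)"
proof -
  have nP: "n \<le> P" "n - 1 \<le> P" using n by auto
  interpret tp: prob_space "tgt n" using prob_tgt nP(1) .
  interpret ep: prob_space "eta n" using prob_eta n .
  note sp = space_eta[OF n]
  note [measurable_cong] = sets_eta[OF n] sets_tgt[OF nP(1)]
  have wm[measurable]: "wt n \<in> borel_measurable (S n)" using n by (rule wt_measurable)
  obtain B where B: "B > 0" "\<forall>x\<in>space (S n). wt n x \<le> B"
    using wt_bound_all[OF n] by blast
  note B = B(1) bspec[OF B(2)]
  have iw: "integrable (eta n) (wt n)"
    using B wt_nonneg by (intro ep.integrable_bounded[where B=B]) (auto simp: sp)
  have c: "(\<integral>y. wt n y \<partial>eta n) = Z n / Z (n - 1)"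
    using integral_eta_wt[OF n, of "\<lambda>_. 1" 1] by (simp add: tp.prob_space)
  \<comment> \<open>The mass of the common part, positive because the mean weight under
    \<open>eta n\<close> is \<open>Z n / Z (n - 1)\<close>.\<close>
  define \<rho> where "\<rho> = (\<integral>y. wt n y / B \<partial>eta n)"
  have "\<rho> = (Z n / Z (n - 1)) / B" by (simp add: \<rho>_def c)
  then have \<rho>0: "\<rho> > 0" using B Z_pos[OF nP(1)] Z_pos[OF nP(2)] by simp
  have \<rho>1: "\<rho> \<le> 1" unfolding \<rho>_def using iw B
    by (intro ep.integral_le_const) (auto simp: sp)
  show ?thesis
  proof (rule that[of "1 - \<rho>"], goal_cases)
    case 3
    show ?case
    proof (intro ballI allI impI)
      fix g :: "(nat \<Rightarrow> 'a) \<Rightarrow> real" and M x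
      assume g: "g \<in> unit_ball (S n)" and gM': "\<forall>x\<in>supp n. \<bar>g x - (\<integral>x. g x \<partial>tgt n)\<bar> \<le> M"
        and x: "x \<in> supp n"
      note gM = bspec[OF gM']
      define m where "m = (\<integral>x. g x \<partial>tgt n)"
      note xs = supp_space[OF x]
      have [measurable]: "g \<in> borel_measurable (S n)" using g by auto
      have [measurable]: "(\<lambda>y. acc n x y) \<in> borel_measurable (S n)" using n xs by measurable
      have gt: "g \<in> unit_ball (tgt n)" using g unit_ball_cong[OF sets_tgt[OF nP(1)]] by auto
      have m1: "\<bar>m\<bar> \<le> 1" unfolding m_def using gt
        by (intro tp.abs_integral_le) (auto dest: unit_ball_bound)
      have g0b: "\<bar>g y - m\<bar> \<le> 2" if "y \<in> space (S n)" for y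
        using unit_ball_bound[OF g that] m1 by linarith
      have ia: "integrable (eta n) (acc n x)"
        using acc_bounds by (intro ep.integrable_bounded[where B=1]) (auto simp: abs_le_iff intro: order_trans[of _ 0])
      have iag: "integrable (eta n) (\<lambda>y. acc n x y * (g y - m))"
      proof (rule ep.integrable_bounded[where B="1 * 2"])
        fix y assume "y \<in> space (eta n)"
        then show "\<bar>acc n x y * (g y - m)\<bar> \<le> 1 * 2"
          unfolding abs_mult using acc_bounds[of n x y] g0b[of y] by (intro mult_mono) (auto simp: sp)
      qed measurable
      have iwg: "integrable (eta n) (\<lambda>y. wt n y * (g y - m))"
      proof (rule ep.integrable_bounded[where B="B * 2"])
        fix y assume "y \<in> space (eta n)"
        then show "\<bar>wt n y * (g y - m)\<bar> \<le> B * 2"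
          unfolding abs_mult using wt_nonneg[of n y] B(1) B(2)[of y] g0b[of y]
          by (intro mult_mono) (auto simp: sp)
      qed measurable
      have "(\<integral>y. wt n y * (g y - m) \<partial>eta n) = Z n / Z (n - 1) * (\<integral>y. g y - m \<partial>tgt n)"
        by (rule integral_eta_wt[OF n _ g0b]) measurable
      also have "(\<integral>y. g y - m \<partial>tgt n) = 0"
        using tp.integrable_unit_ball[OF gt] by (simp add: m_def tp.prob_space)
      finally have w0: "(\<integral>y. wt n y * (g y - m) \<partial>eta n) = 0" by simp
      have aw: "wt n y / B \<le> acc n x y" if y: "y \<in> space (S n)" for y
        unfolding acc_eq[OF n x y] using B(2)[OF y] B(2)[OF xs] wt_pos[OF n x] wt_nonneg[of n y] B(1)
        by (auto intro!: divide_left_mono)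
      \<comment> \<open>Off the support \<open>g\<close> need not be within \<open>M\<close> of its
        mean, but there \<open>wt n y\<close>, hence the acceptance probability, is 0.\<close>
      have pw: "\<bar>(acc n x y - wt n y / B) * (g y - m)\<bar> \<le> M * (acc n x y - wt n y / B)" if y: "y \<in> space (S n)" for y
      proof (cases "y \<in> supp n")
        case True
        then show ?thesis using gM[OF True] aw[OF y]
          by (simp add: abs_mult mult.commute mult_right_mono m_def)
      next
        case False
        then show ?thesis using wt_off_supp[OF n y] by (simp add: acc_eq[OF n x y])
      qed
      define a where "a = (\<integral>y. acc n x y \<partial>eta n)"
      have a1: "a \<le> 1" unfolding a_def using ia acc_bounds by (intro ep.integral_le_const) auto
      have "K n g x - m = (g x - m) + (\<integral>y. acc n x y * (g y - m) - acc n x y * (g x - m) \<partial>eta n)"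
        by (simp add: mh_def algebra_simps)
      also have "(\<integral>y. acc n x y * (g y - m) - acc n x y * (g x - m) \<partial>eta n)
          = (\<integral>y. acc n x y * (g y - m) \<partial>eta n) - a * (g x - m)"
        using iag ia by (simp add: a_def)
      also have "(g x - m) + ((\<integral>y. acc n x y * (g y - m) \<partial>eta n) - a * (g x - m))
          = (g x - m) * (1 - a) + (\<integral>y. acc n x y * (g y - m) \<partial>eta n)"
        by (simp add: algebra_simps)
      \<comment> \<open>Subtracting \<open>wt n y * (g y - m) / B\<close> costs nothing, by
        \<open>w0\<close>; the kernel left over has mass \<open>a - \<rho>\<close>, and the
        rejection part has mass \<open>1 - a\<close>.\<close>
      also have "(\<integral>y. acc n x y * (g y - m) \<partial>eta n)
          = (\<integral>y. acc n x y * (g y - m) - wt n y * (g y - m) / B \<partial>eta n)"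
        using iag iwg w0 by simp
      also have "\<dots> = (\<integral>y. (acc n x y - wt n y / B) * (g y - m) \<partial>eta n)"
        by (simp add: algebra_simps)
      finally have K: "K n g x - m = (g x - m) * (1 - a) + (\<integral>y. (acc n x y - wt n y / B) * (g y - m) \<partial>eta n)" .
      have i1: "integrable (eta n) (\<lambda>y. (acc n x y - wt n y / B) * (g y - m))"
        using Bochner_Integration.integrable_diff[OF iag integrable_divide[OF iwg, of B]] by (simp add: algebra_simps)
      have i2: "integrable (eta n) (\<lambda>y. M * (acc n x y - wt n y / B))" using ia iw by simp
      have "\<bar>\<integral>y. (acc n x y - wt n y / B) * (g y - m) \<partial>eta n\<bar> \<le> (\<integral>y. M * (acc n x y - wt n y / B) \<partial>eta n)"
        by (rule order_trans[OF integral_abs_bound integral_mono]) (use i1 i2 pw in \<open>auto simp: sp\<close>)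
      also have "\<dots> = M * (a - \<rho>)" using ia iw by (simp add: a_def \<rho>_def)
      finally have 2: "\<bar>\<integral>y. (acc n x y - wt n y / B) * (g y - m) \<partial>eta n\<bar> \<le> M * (a - \<rho>)" .
      have "\<bar>(g x - m) * (1 - a)\<bar> \<le> M * (1 - a)"
        using gM[OF x] a1 by (simp add: abs_mult mult_right_mono m_def)
      with 2 have "\<bar>K n g x - m\<bar> \<le> M * (1 - a) + M * (a - \<rho>)" unfolding K by linarith
      then show "\<bar>K n g x - (\<integral>x. g x \<partial>tgt n)\<bar> \<le> (1 - \<rho>) * M" by (simp add: m_def algebra_simps)
    qed
  qed (use \<rho>0 \<rho>1 in auto)
qed

lemma K_power_unit_ball: "n \<in> {1..P} \<Longrightarrow> g \<in> unit_ball (S n) \<Longrightarrow> (K n ^^ k) g \<in> unit_ball (S n)"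
  by (induction k) (auto intro: K_unit_ball)

text \<open>Invariance keeps the mean of all iterates equal to that of \<open>g\<close>, so the
  contraction can be iterated around one and the same number. The initial distance is at most 2, as
  \<open>g\<close> and its mean are both bounded by 1.\<close>

lemma K_power_converges:
  assumes n: "n \<in> {1..P}"
  obtains r where "0 \<le> r" "r < 1"
    "\<And>g k x. g \<in> unit_ball (S n) \<Longrightarrow> x \<in> supp n \<Longrightarrow> \<bar>(K n ^^ k) g x - (\<integral>x. g x \<partial>tgt n)\<bar> \<le> 2 * r ^ k"
proof -
  have nP: "n \<le> P" using n by auto
  interpret tp: prob_space "tgt n" using prob_tgt nP .
  obtain r where r: "0 \<le> r" "r < 1"
    and c: "\<forall>g\<in>unit_ball (S n). \<forall>M. (\<forall>x\<in>supp n. \<bar>g x - (\<integral>x. g x \<partial>tgt n)\<bar> \<le> M)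
      \<longrightarrow> (\<forall>x\<in>supp n. \<bar>K n g x - (\<integral>x. g x \<partial>tgt n)\<bar> \<le> r * M)"
    by (rule K_contraction[OF n])
  show ?thesis
  proof (rule that[OF r])
    fix g k and x :: "nat \<Rightarrow> 'a" assume g: "g \<in> unit_ball (S n)" and x: "x \<in> supp n"
    have inv: "(\<integral>x. (K n ^^ k) g x \<partial>tgt n) = (\<integral>x. g x \<partial>tgt n)" for k
      by (induction k) (simp_all add: target_invariant[OF n K_power_unit_ball[OF n g]])
    show "\<bar>(K n ^^ k) g x - (\<integral>x. g x \<partial>tgt n)\<bar> \<le> 2 * r ^ k"
      using x
    proof (induction k arbitrary: x)
      case 0
      have "g \<in> unit_ball (tgt n)" using g unit_ball_cong[OF sets_tgt[OF nP]] by auto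
      then have "\<bar>\<integral>x. g x \<partial>tgt n\<bar> \<le> 1" by (intro tp.abs_integral_le) (auto dest: unit_ball_bound)
      then show ?case using unit_ball_bound[OF g supp_space[OF 0]] by simp
    next
      case (Suc k)
      have "\<forall>x\<in>supp n. \<bar>(K n ^^ k) g x - (\<integral>x. (K n ^^ k) g x \<partial>tgt n)\<bar> \<le> 2 * r ^ k"
        using Suc.IH unfolding inv by auto
      from c[THEN bspec, OF K_power_unit_ball[OF n g, of k], THEN spec, THEN mp, OF this] have "\<forall>x\<in>supp n. \<bar>K n ((K n ^^ k) g) x - (\<integral>x. (K n ^^ k) g x \<partial>tgt n)\<bar> \<le> r * (2 * r ^ k)"
 .
      then show ?case using Suc.prems by (simp add: inv mult.left_commute)
    qed
  qed
qed

end

lemma measurable_bernoulli: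
  assumes [measurable]: "a \<in> borel_measurable M" and a: "\<And>w. 0 \<le> a w" "\<And>w. a w \<le> 1"
  shows "(\<lambda>w. measure_pmf (bernoulli_pmf (a w))) \<in> M \<rightarrow>\<^sub>M prob_algebra (count_space UNIV)"
proof (intro measurable_prob_algebraI measurable_subprob_algebra)
  fix A :: "bool set"
  have "emeasure (measure_pmf (bernoulli_pmf (a w))) A
      = indicator A True * ennreal (a w) + indicator A False * ennreal (1 - a w)" for w
    using nn_integral_bernoulli_pmf[OF a(1)[of w] a(2)[of w], of "indicator A"]
    by (simp add: ennreal_minus[OF a(1), symmetric])
  then show "(\<lambda>w. emeasure (measure_pmf (bernoulli_pmf (a w))) A) \<in> borel_measurable M" by simp
qed (auto intro: prob_space_measure_pmf subprob_space_measure_pmf)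

lemma pmf_prob_algebra: "measure_pmf p \<in> space (prob_algebra (count_space UNIV))"
  by (simp add: space_prob_algebra prob_space_measure_pmf)

context simcmc_setup
begin

subsection \<open>The law of the trajectory\<close>

lemma coord_measurable: "k \<in> {1..P} \<Longrightarrow> (\<lambda>h. h (k, i)) \<in> T \<rightarrow>\<^sub>M S k"
  using measurable_component_singleton[of "(k, i)" "{1..P} \<times> UNIV" "\<lambda>(n, i). path_space E n"]
  by (simp add: trajectory_space_def)

lemma coord_measurable'[measurable (raw)]:
  "k \<in> {1..P} \<Longrightarrow> f \<in> M \<rightarrow>\<^sub>M T \<Longrightarrow> (\<lambda>w. f w (k, i)) \<in> M \<rightarrow>\<^sub>M S k"
  by (rule measurable_compose[OF _ coord_measurable])

lemma coord_space: "k \<in> {1..P} \<Longrightarrow> h \<in> space T \<Longrightarrow> h (k, i) \<in> space (S k)"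
  by (rule measurable_space[OF coord_measurable])

lemma update_measurable[measurable (raw)]:
  assumes "k \<in> {1..P}" "f \<in> M \<rightarrow>\<^sub>M T" "g \<in> M \<rightarrow>\<^sub>M S k"
  shows "(\<lambda>w. (f w)((k, i) := g w)) \<in> M \<rightarrow>\<^sub>M T"
  unfolding trajectory_space_def
  by (rule measurable_fun_upd[where J="{1..P} \<times> UNIV"]) (use assms in \<open>auto simp: trajectory_space_def\<close>)

text \<open>The state that a proposal at level \<open>n\<close> extends when the uniformly drawn
  past time is \<open>m\<close>; at level 1 it is the only point of \<open>S 0\<close>.\<close>

definition parent :: "nat \<Rightarrow> 'a trajectory \<Rightarrow> nat \<Rightarrow> nat \<Rightarrow> 'a" where
  "parent n h m = (if n = 1 then (\<lambda>_. undefined) else h (n - 1, m))"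

lemma parent_measurable:
  assumes n: "n \<in> {1..P}" shows "(\<lambda>h. parent n h m) \<in> T \<rightarrow>\<^sub>M S (n - 1)"
proof (cases "n = 1")
  case True
  then show ?thesis by (simp add: parent_def space_S_0)
next
  case False
  with n have "n - 1 \<in> {1..P}" by auto
  with False coord_measurable[of "n - 1" m] show ?thesis by (simp add: parent_def)
qed

lemma parent_space: "n \<in> {1..P} \<Longrightarrow> h \<in> space T \<Longrightarrow> parent n h m \<in> space (S (n - 1))"
  by (rule measurable_space[OF parent_measurable])

text \<open>The averaged point masses are the law of \<open>h (k, m)\<close> for \<open>m\<close>
  uniform on \<open>{..i}\<close>. A \<open>distr\<close> is a genuine measure, so
  \<open>measure_of\<close> really takes the prescribed values and the calculus of
  \<open>bind\<close> applies.\<close>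

lemma empirical_eq:
  assumes h: "\<And>m. h (k, m) \<in> space (S k)"
  shows "empirical_measure E h k i = distr (measure_pmf (pmf_of_set {..i})) (S k) (\<lambda>m. h (k, m))"
    (is "_ = ?D")
proof -
  have "?D = measure_of (space ?D) (sets ?D) (emeasure ?D)" by (rule measure_of_of_measure[symmetric])
  also have "\<dots> = empirical_measure E h k i"
    unfolding empirical_measure_def space_distr sets_distr
  proof (rule measure_of_eq)
    fix A assume "A \<in> sigma_sets (space (S k)) (sets (S k))"
    then have A: "A \<in> sets (S k)" by (simp add: sets.sigma_sets_eq)
    have "emeasure ?D A = (\<integral>\<^sup>+m. indicator A (h (k, m)) \<partial>measure_pmf (pmf_of_set {..i}))"
      using h A nn_integral_distr[of "\<lambda>m. h (k, m)" "measure_pmf (pmf_of_set {..i})" "S k" "indicator A"]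
      by simp
    also have "\<dots> = (\<Sum>m\<le>i. indicator A (h (k, m))) / of_nat (i + 1)"
      by (subst nn_integral_pmf_of_set) (auto simp: ennreal_of_nat_eq_real_of_nat add.commute)
    also have "(\<Sum>m\<le>i. indicator A (h (k, m))) = (\<Sum>m\<le>i. emeasure (return (S k) (h (k, m))) A)"
      using A by simp
    finally show "emeasure ?D A = (\<Sum>m\<le>i. emeasure (return (S k) (h (k, m))) A) / of_nat (i + 1)" .
  qed (rule sets.space_closed)
  finally show ?thesis by simp
qed

lemma kern_parent_measurable:
  assumes n: "n \<in> {1..P}"
  shows "(\<lambda>(h, m). kern n (parent n h m)) \<in> T \<Otimes>\<^sub>M count_space UNIV \<rightarrow>\<^sub>M prob_algebra (S n)"
  unfolding case_prod_beta
  by (rule measurable_compose_countable[where f="\<lambda>m z. kern n (parent n (fst z) m)" and g=snd])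
     (auto intro!: measurable_compose[OF _ kern_measurable[OF n]] measurable_compose[OF _ parent_measurable[OF n]])

text \<open>Sampling from an empirical measure amounts to drawing a past time uniformly. At level 1
  the drawn time is a dummy: the kernel is constant in \<open>m\<close>.\<close>

lemma proposal_eq:
  assumes n: "n \<in> {1..P}" and h: "h \<in> space T"
  shows "proposal E \<nu> q h n i = measure_pmf (pmf_of_set {..i}) \<bind> (\<lambda>m. kern n (parent n h m))"
proof (cases "n = 1")
  case True
  have k: "prob_space (kern n (\<lambda>_. undefined))"
    using kern_space[OF n, of "\<lambda>_. undefined"] True by (simp add: space_S_0 space_prob_algebra)
  then show ?thesis
    using bind_const'[OF prob_space_measure_pmf[of "pmf_of_set {..i}"] prob_space_imp_subprob_space[OF k]] True
    by (simp add: proposal_def parent_def kern_def)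
next
  case False
  with n have n': "n - 1 \<in> {1..P}" by auto
  show ?thesis
    using False unfolding proposal_def extend_by_def kern_def[symmetric]
    using empirical_eq[of h "n - 1" i, OF coord_space[OF n' h]]
    by (simp add: parent_def, subst bind_distr[where K="S n"])
       (use n coord_space[OF n' h] in \<open>auto intro: measurable_prob_algebraD\<close>)
qed

lemma proposal_measurable:
  assumes n: "n \<in> {1..P}"
  shows "(\<lambda>h. proposal E \<nu> q h n i) \<in> T \<rightarrow>\<^sub>M prob_algebra (S n)"
proof -
  have "(\<lambda>h. measure_pmf (pmf_of_set {..i}) \<bind> (\<lambda>m. kern n (parent n h m))) \<in> T \<rightarrow>\<^sub>M prob_algebra (S n)"
    by (rule measurable_bind_prob_space2[OF _ kern_parent_measurable[OF n]])
       (simp add: pmf_prob_algebra)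
  also have "?this \<longleftrightarrow> ?thesis" by (rule measurable_cong) (simp add: proposal_eq[OF n])
  finally show ?thesis .
qed

lemma proposal_space: "n \<in> {1..P} \<Longrightarrow> h \<in> space T \<Longrightarrow> proposal E \<nu> q h n i \<in> space (prob_algebra (S n))"
  by (rule measurable_space[OF proposal_measurable])

lemma integral_proposal:
  fixes f :: "(nat \<Rightarrow> 'a) \<Rightarrow> real"
  assumes n: "n \<in> {1..P}" and h: "h \<in> space T"
    and f: "f \<in> borel_measurable (S n)" "\<And>x. x \<in> space (S n) \<Longrightarrow> \<bar>f x\<bar> \<le> C"
  shows "(\<integral>y. f y \<partial>proposal E \<nu> q h n i) = (\<Sum>m\<le>i. (\<integral>y. f y \<partial>kern n (parent n h m))) / real (i + 1)"
proof -
  have "(\<lambda>m. kern n (parent n h m)) \<in> count_space UNIV \<rightarrow>\<^sub>M prob_algebra (S n)"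
    using kern_space[OF n parent_space[OF n h]] by auto
  then have "(\<integral>y. f y \<partial>proposal E \<nu> q h n i)
      = (\<integral>m. (\<integral>y. f y \<partial>kern n (parent n h m)) \<partial>measure_pmf (pmf_of_set {..i}))"
    unfolding proposal_eq[OF n h] by (intro integral_bind_prob[OF pmf_prob_algebra _ f])
  then show ?thesis by (simp add: integral_pmf_of_set)
qed

definition accept_step :: "nat \<Rightarrow> nat \<Rightarrow> 'a trajectory \<Rightarrow> (nat \<Rightarrow> 'a) \<Rightarrow> 'a trajectory measure" where
  "accept_step i n h y = measure_pmf (bernoulli_pmf (acc n (h (n, i - 1)) y)) \<bind> (\<lambda>accept.
         return T (h((n, i) := (if accept then y else h (n, i - 1)))))"

lemma update_level_eq:
  "update_level E \<nu> \<gamma> q P i n h = proposal E \<nu> q h n i \<bind> accept_step i n h"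
  unfolding update_level_def accept_step_def[abs_def] ..

lemma accept_step_measurable:
  assumes n: "n \<in> {1..P}"
  shows "(\<lambda>(h, y). accept_step i n h y) \<in> T \<Otimes>\<^sub>M S n \<rightarrow>\<^sub>M prob_algebra T"
  unfolding accept_step_def case_prod_beta
proof (rule measurable_bind_prob_space2[OF measurable_bernoulli])
  show "(\<lambda>z. acc n (fst z (n, i - 1)) (snd z)) \<in> borel_measurable (T \<Otimes>\<^sub>M S n)"
    using n by measurable
  have 1: "(\<lambda>z. (fst (fst z))((n, i) := snd (fst z))) \<in> (T \<Otimes>\<^sub>M S n) \<Otimes>\<^sub>M count_space UNIV \<rightarrow>\<^sub>M T"
    and 2: "(\<lambda>z. (fst (fst z))((n, i) := fst (fst z) (n, i - 1))) \<in> (T \<Otimes>\<^sub>M S n) \<Otimes>\<^sub>M count_space UNIV \<rightarrow>\<^sub>M T"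
    using n by measurable
  have 3: "(\<lambda>z. (fst (fst z))((n, i) := (if b then snd (fst z) else fst (fst z) (n, i - 1))))
      \<in> (T \<Otimes>\<^sub>M S n) \<Otimes>\<^sub>M count_space UNIV \<rightarrow>\<^sub>M T" for b
    using 1 2 by (cases b) simp_all
  have "(\<lambda>z. (fst (fst z))((n, i) := (if snd z then snd (fst z) else fst (fst z) (n, i - 1))))
     \<in> (T \<Otimes>\<^sub>M S n) \<Otimes>\<^sub>M count_space UNIV \<rightarrow>\<^sub>M T"
    by (rule measurable_compose_countable[where g=snd
          and f="\<lambda>b z. (fst (fst z))((n, i) := (if b then snd (fst z) else fst (fst z) (n, i - 1)))"])
       (rule 3, simp)
  from measurable_compose[OF this measurable_return_prob_space]
  show "(\<lambda>(z, b). return T ((fst z)((n, i) := (if b then snd z else fst z (n, i - 1)))))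
     \<in> (T \<Otimes>\<^sub>M S n) \<Otimes>\<^sub>M count_space UNIV \<rightarrow>\<^sub>M prob_algebra T"
    by (simp add: case_prod_beta)
qed (auto simp: acc_bounds)

lemma update_level_measurable:
  assumes n: "n \<in> {1..P}"
  shows "update_level E \<nu> \<gamma> q P i n \<in> T \<rightarrow>\<^sub>M prob_algebra T"
  using measurable_bind_prob_space2[OF proposal_measurable[OF n] accept_step_measurable[OF n]]
  unfolding update_level_eq[abs_def] .

lemma update_space: "n \<in> {1..P} \<Longrightarrow> h \<in> space T \<Longrightarrow> y \<in> space (S n) \<Longrightarrow> h((n, i) := y) \<in> space T"
  by (rule measurable_space[OF update_measurable[of n "\<lambda>_. h" "count_space UNIV" "\<lambda>_. y"]]) auto

lemma integral_accept_step:
  fixes F :: "'a trajectory \<Rightarrow> real"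
  assumes n: "n \<in> {1..P}" and h: "h \<in> space T" and y: "y \<in> space (S n)"
    and F: "F \<in> borel_measurable T" "\<And>h. h \<in> space T \<Longrightarrow> \<bar>F h\<bar> \<le> C"
  shows "(\<integral>h'. F h' \<partial>accept_step i n h y) = acc n (h (n, i - 1)) y * F (h((n, i) := y))
    + (1 - acc n (h (n, i - 1)) y) * F (h((n, i) := h (n, i - 1)))"
proof -
  have sp: "h((n, i) := (if b then y else h (n, i - 1))) \<in> space T" for b
    using update_space[OF n h] y coord_space[OF n h] by auto
  have "(\<integral>h'. F h' \<partial>accept_step i n h y) = (\<integral>b. (\<integral>h'. F h' \<partial>return T (h((n, i) := (if b then y else h (n, i - 1)))))
      \<partial>measure_pmf (bernoulli_pmf (acc n (h (n, i - 1)) y)))"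
    unfolding accept_step_def
    by (rule integral_bind_prob[OF pmf_prob_algebra _ F])
       (use sp in \<open>auto intro!: measurable_space[OF measurable_return_prob_space]\<close>)
  also have "\<dots> = (\<integral>b. F (h((n, i) := (if b then y else h (n, i - 1))))
      \<partial>measure_pmf (bernoulli_pmf (acc n (h (n, i - 1)) y)))"
    by (simp add: integral_return[OF sp F(1)])
  also have "\<dots> = acc n (h (n, i - 1)) y * F (h((n, i) := y))
    + (1 - acc n (h (n, i - 1)) y) * F (h((n, i) := h (n, i - 1)))"
    by (subst integral_bernoulli_pmf) (simp_all add: acc_bounds)
  finally show ?thesis .
qed

text \<open>Made for integrands that are a past-dependent factor times a function \<open>G\<close>
  of the new state: once \<open>h\<close> is fixed, the factor is a number \<open>c\<close>.\<close>

lemma integral_update_level: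
  fixes F :: "'a trajectory \<Rightarrow> real"
  assumes n: "n \<in> {1..P}" and h: "h \<in> space T"
    and F: "F \<in> borel_measurable T" "\<And>h. h \<in> space T \<Longrightarrow> \<bar>F h\<bar> \<le> C"
    and A: "\<And>y. F (h((n, i) := y)) = c * G y"
  shows "(\<integral>h'. F h' \<partial>update_level E \<nu> \<gamma> q P i n h) = c * mh n (proposal E \<nu> q h n i) G (h (n, i - 1))"
proof -
  have ps: "proposal E \<nu> q h n i \<in> space (prob_algebra (S n))" using proposal_space[OF n h] .
  then have sets: "sets (proposal E \<nu> q h n i) = sets (S n)" and "prob_space (proposal E \<nu> q h n i)"
    by (auto simp: space_prob_algebra)
  interpret p: prob_space "proposal E \<nu> q h n i" by fact
  have "accept_step i n h \<in> S n \<rightarrow>\<^sub>M prob_algebra T"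
    using measurable_compose[OF measurable_Pair1'[OF h] accept_step_measurable[OF n]] by simp
  then have "(\<integral>h'. F h' \<partial>update_level E \<nu> \<gamma> q P i n h)
      = (\<integral>y. (\<integral>h'. F h' \<partial>accept_step i n h y) \<partial>proposal E \<nu> q h n i)"
    unfolding update_level_eq by (intro integral_bind_prob[OF ps _ F])
  also have "\<dots> = (\<integral>y. c * G (h (n, i - 1)) + c * (acc n (h (n, i - 1)) y * (G y - G (h (n, i - 1)))) \<partial>proposal E \<nu> q h n i)"
  proof (rule Bochner_Integration.integral_cong[OF refl])
    fix y assume "y \<in> space (proposal E \<nu> q h n i)"
    then have y: "y \<in> space (S n)" using sets_eq_imp_space_eq[OF sets] by simp
    show "(\<integral>h'. F h' \<partial>accept_step i n h y)
        = c * G (h (n, i - 1)) + c * (acc n (h (n, i - 1)) y * (G y - G (h (n, i - 1))))"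
      by (simp add: integral_accept_step[OF n h y F] A algebra_simps)
  qed
  also have "\<dots> = c * mh n (proposal E \<nu> q h n i) G (h (n, i - 1))"
  \<comment> \<open>For nonzero \<open>c\<close>, measurability and boundedness of \<open>G\<close>
    are recovered from those of \<open>F\<close>; for \<open>c = 0\<close> nothing is known about
    \<open>G\<close>, but both sides are 0.\<close>
  proof (cases "c = 0")
    case False
    have [measurable]: "(\<lambda>y. c * G y) \<in> borel_measurable (S n)"
      unfolding A[symmetric] using n h F(1) by measurable
    have Gm: "G \<in> borel_measurable (S n)"
      using borel_measurable_times[OF borel_measurable_const[of "1 / c"] \<open>(\<lambda>y. c * G y) \<in> borel_measurable (S n)\<close>] False by simp
    define D where "D = C / \<bar>c\<bar>"
    have Gb: "\<bar>G y\<bar> \<le> D" if "y \<in> space (S n)" for y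
      using F(2)[OF update_space[OF n h that, of i]] False unfolding A D_def by (simp add: abs_mult field_simps)
    have x: "h (n, i - 1) \<in> space (S n)" using coord_space[OF n h] .
    have "integrable (proposal E \<nu> q h n i) (\<lambda>y. acc n (h (n, i - 1)) y * (G y - G (h (n, i - 1))))"
    proof (rule p.integrable_bounded[where B="1 * (D + D)"])
      show "(\<lambda>y. acc n (h (n, i - 1)) y * (G y - G (h (n, i - 1)))) \<in> borel_measurable (proposal E \<nu> q h n i)"
        unfolding measurable_cong_sets[OF sets refl] using Gm n x by measurable
      fix y assume "y \<in> space (proposal E \<nu> q h n i)"
      then have y: "y \<in> space (S n)" using sets_eq_imp_space_eq[OF sets] by simp
      show "\<bar>acc n (h (n, i - 1)) y * (G y - G (h (n, i - 1)))\<bar> \<le> 1 * (D + D)"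
        unfolding abs_mult using Gb[OF y] Gb[OF x] acc_bounds[of n "h (n, i - 1)" y]
        by (intro mult_mono) auto
    qed
    then show ?thesis by (simp add: mh_def p.prob_space distrib_left)
  qed simp
  finally show ?thesis .
qed

lemma update_levels_measurable: "k \<le> P \<Longrightarrow> update_levels E \<nu> \<gamma> q P i k \<in> T \<rightarrow>\<^sub>M prob_algebra T"
proof (induction k)
  case 0
  have "update_levels E \<nu> \<gamma> q P i 0 = return T" by (rule ext) simp
  then show ?case using measurable_return_prob_space[of T] by simp
next
  case (Suc k)
  have "update_levels E \<nu> \<gamma> q P i (Suc k) = (\<lambda>h. update_levels E \<nu> \<gamma> q P i k h \<bind> update_level E \<nu> \<gamma> q P i (Suc k))"
    by (rule ext) simp
  then show ?case using Suc update_level_measurable[of "Suc k" i] by (auto intro!: measurable_bind_prob_space)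
qed

section \<open>Laws along the iteration and the Markov property\<close>

abbreviation "law i \<equiv> simcmc E \<nu> \<gamma> q P x0 i"

lemma initial_space: "initial_trajectory P x0 \<in> space T"
  using x0_supp supp_space by (auto simp: trajectory_space_def initial_trajectory_def space_PiM)

lemma law_space: "law i \<in> space (prob_algebra T)"
proof (induction i)
  case 0
  then show ?case using measurable_space[OF measurable_return_prob_space initial_space] by simp
next
  case (Suc i)
  then show ?case
    using prob_space_bind'[OF Suc update_levels_measurable[of P "Suc i"]] sets_bind'[OF Suc update_levels_measurable[of P "Suc i"]]
    by (simp add: space_prob_algebra)
qed

lemma sets_law[measurable_cong, simp]: "sets (law i) = sets T"
  and prob_law: "prob_space (law i)"
  using law_space[of i] by (auto simp: space_prob_algebra)

lemma space_law[simp]: "space (law i) = space T"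
  using sets_law by (rule sets_eq_imp_space_eq)

text \<open>The law in the middle of iteration \<open>i + 1\<close>, after its levels 1 to
  \<open>k\<close>. At this moment the past of the draw at level \<open>k + 1\<close> is complete,
  so conditioning can be expressed here.\<close>

definition partial_law :: "nat \<Rightarrow> nat \<Rightarrow> 'a trajectory measure" where
  "partial_law i k = law i \<bind> update_levels E \<nu> \<gamma> q P (Suc i) k"

lemma partial_law_0: "partial_law i 0 = law i"
proof -
  have "update_levels E \<nu> \<gamma> q P (Suc i) 0 = return T" by (rule ext) simp
  then show ?thesis unfolding partial_law_def using bind_return''[OF sets_law] by simp
qed

lemma partial_law_P: "partial_law i P = law (Suc i)"
  by (simp add: partial_law_def)

lemma partial_law_Suc:
  assumes "Suc k \<le> P"
  shows "partial_law i (Suc k) = partial_law i k \<bind> update_level E \<nu> \<gamma> q P (Suc i) (Suc k)"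
proof -
  have "update_levels E \<nu> \<gamma> q P (Suc i) (Suc k)
      = (\<lambda>h. update_levels E \<nu> \<gamma> q P (Suc i) k h \<bind> update_level E \<nu> \<gamma> q P (Suc i) (Suc k))"
    by (rule ext) simp
  moreover have "update_levels E \<nu> \<gamma> q P (Suc i) k \<in> law i \<rightarrow>\<^sub>M subprob_algebra T"
    using assms update_levels_measurable[of k "Suc i"]
    by (auto intro!: measurable_prob_algebraD cong: measurable_cong_sets)
  moreover have "update_level E \<nu> \<gamma> q P (Suc i) (Suc k) \<in> T \<rightarrow>\<^sub>M subprob_algebra T"
    using assms by (auto intro!: measurable_prob_algebraD update_level_measurable)
  ultimately show ?thesis unfolding partial_law_def by (simp add: bind_assoc)
qed

lemma partial_law_space: "k \<le> P \<Longrightarrow> partial_law i k \<in> space (prob_algebra T)"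
  unfolding partial_law_def
  using prob_space_bind'[OF law_space update_levels_measurable] sets_bind'[OF law_space update_levels_measurable]
  by (simp add: space_prob_algebra)

text \<open>
  \<open>F\<close> does not read the entries that are written only after level \<open>k\<close> of iteration \<open>i + 1\<close>,
  i.e. \<open>F\<close> is measurable with respect to the past at that moment.
\<close>
definition settled :: "nat \<Rightarrow> nat \<Rightarrow> ('a trajectory \<Rightarrow> real) \<Rightarrow> bool" where
  "settled i k F \<longleftrightarrow> F \<in> borel_measurable T \<and> (\<exists>C. \<forall>h\<in>space T. \<bar>F h\<bar> \<le> C) \<and>
     (\<forall>h k' i' y. i' > Suc i \<or> (i' = Suc i \<and> k' > k) \<longrightarrow> F (h((k', i') := y)) = F h)"

lemma settledD:
  assumes "settled i k F"
  shows settled_measurable: "F \<in> borel_measurable T"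
    and settled_bounded: "\<exists>C. \<forall>h\<in>space T. \<bar>F h\<bar> \<le> C"
    and settled_update: "i' > Suc i \<or> (i' = Suc i \<and> k' > k) \<Longrightarrow> F (h((k', i') := y)) = F h"
  using assms unfolding settled_def by auto

lemma settled_mono: "settled i k F \<Longrightarrow> i < i' \<or> (i = i' \<and> k \<le> k') \<Longrightarrow> settled i' k' F"
  unfolding settled_def by (elim conjE) (intro conjI, assumption, assumption, auto)

lemma settled_step:
  assumes s: "settled i k F" and k: "k \<le> k'" "Suc k' \<le> P"
  shows "(\<integral>h. F h \<partial>partial_law i (Suc k')) = (\<integral>h. F h \<partial>partial_law i k')"
proof -
  obtain C where "\<forall>h\<in>space T. \<bar>F h\<bar> \<le> C" using settled_bounded[OF s] by blast
  note F = settled_measurable[OF s] bspec[OF this]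
  have n: "Suc k' \<in> {1..P}" using k by auto
  have "(\<integral>h. F h \<partial>partial_law i (Suc k'))
      = (\<integral>h. (\<integral>h'. F h' \<partial>update_level E \<nu> \<gamma> q P (Suc i) (Suc k') h) \<partial>partial_law i k')"
    unfolding partial_law_Suc[OF k(2)] using k
    by (intro integral_bind_prob[OF partial_law_space update_level_measurable[OF n] F]) auto
  also have "\<dots> = (\<integral>h. F h \<partial>partial_law i k')"
  proof (rule Bochner_Integration.integral_cong[OF refl])
    fix h assume "h \<in> space (partial_law i k')"
    then have h: "h \<in> space T"
      using partial_law_space[of k' i] k by (auto simp: space_prob_algebra dest: sets_eq_imp_space_eq)
    \<comment> \<open>With the constant test function 1 the increment in \<open>mh\<close> vanishes,
      so an update that \<open>F\<close> does not read preserves the integral.\<close>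
    have u: "F (h((Suc k', Suc i) := y)) = F h * (\<lambda>_. 1) y" for y
      using s k by (auto simp: settled_def)
    show "(\<integral>h'. F h' \<partial>update_level E \<nu> \<gamma> q P (Suc i) (Suc k') h) = F h"
      by (subst integral_update_level[OF n h F u]) (simp_all add: mh_def)
  qed
  finally show ?thesis .
qed

lemma settled_partial_law:
  assumes s: "settled i k F" and k: "k \<le> k'" "k' \<le> P"
  shows "(\<integral>h. F h \<partial>partial_law i k') = (\<integral>h. F h \<partial>partial_law i k)"
  using k
proof (induction k' rule: dec_induct)
  case (step j)
  then show ?case using settled_step[OF s, of j] by simp
qed simp

text \<open>Later updates overwrite only entries that \<open>F\<close> does not read. Hence one late
  time \<open>I\<close> can serve for all past quantities at once.\<close>

lemma settled_law:
  assumes s: "settled i k F" and k: "k \<le> P" and I: "i < I"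
  shows "(\<integral>h. F h \<partial>law I) = (\<integral>h. F h \<partial>partial_law i k)"
  using I[THEN Suc_leI]
proof (induction I rule: dec_induct)
  case base
  then show ?case using settled_partial_law[OF s, of P] k by (simp only: partial_law_P order_refl)
next
  case (step j)
  have "settled j 0 F" using settled_mono[OF s] step by auto
  then have "(\<integral>h. F h \<partial>partial_law j P) = (\<integral>h. F h \<partial>partial_law j 0)"
    by (rule settled_partial_law) auto
  then show ?case using step by (simp only: partial_law_P partial_law_0)
qed

text \<open>A proposal at level \<open>n\<close> in iteration \<open>i\<close> reads level
  \<open>n - 1\<close> up to time \<open>i\<close> inclusive, since that level is processed earlier
  in the same iteration.\<close>

lemma proposal_update_irrelevant:
  assumes "i' > i \<or> (i' = i \<and> k' > n - 1)"
  shows "proposal E \<nu> q (h((k', i') := y)) n i = proposal E \<nu> q h n i"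
proof -
  have "\<And>m. m \<le> i \<Longrightarrow> (h((k', i') := y)) (n - 1, m) = h (n - 1, m)" using assms by auto
  then show ?thesis unfolding proposal_def empirical_measure_def by (simp del: fun_upd_apply)
qed

text \<open>The conditional expectation of the new state given the past, tested against a bounded
  past factor \<open>A\<close>. The left integrand is settled once level \<open>n\<close> of
  iteration \<open>i + 1\<close> is done, the right one already before that draw; thus both
  integrals can be taken back from \<open>law I\<close> to the two sides of one update.\<close>

lemma markov_property:
  assumes n: "n \<in> {1..P}" and i: "i < I" and A: "settled i (n - 1) A" and G: "G \<in> unit_ball (S n)"
  shows "(\<integral>h. A h * G (h (n, Suc i)) \<partial>law I)
       = (\<integral>h. A h * mh n (proposal E \<nu> q h n (Suc i)) G (h (n, i)) \<partial>law I)"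
proof -
  have n1: "n - 1 \<le> P" "n \<le> P" "Suc (n - 1) = n" using n by auto
  obtain C where "\<forall>h\<in>space T. \<bar>A h\<bar> \<le> C" using settled_bounded[OF A] by blast
  note Ab = bspec[OF this] and Am = settled_measurable[OF A] and Ai = settled_update[OF A]
  have Gm[measurable]: "G \<in> borel_measurable (S n)" using G by auto
  have C: "\<bar>A h * g\<bar> \<le> C * 1" if "h \<in> space T" "\<bar>g\<bar> \<le> 1" for h g
    unfolding abs_mult using Ab[OF that(1)] that(2) by (intro mult_mono) auto
  have F: "(\<lambda>h. A h * G (h (n, Suc i))) \<in> borel_measurable T" using Am n by measurable
  have Fb: "\<bar>A h * G (h (n, Suc i))\<bar> \<le> C * 1" if "h \<in> space T" for h
    using C[OF that] unit_ball_bound[OF G coord_space[OF n that]] .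
  have s1: "settled i n (\<lambda>h. A h * G (h (n, Suc i)))"
    unfolding settled_def using F Fb Ai n by auto
  have R: "(\<lambda>h. A h * mh n (proposal E \<nu> q h n (Suc i)) G (h (n, i))) \<in> borel_measurable T"
    by (intro borel_measurable_times Am mh_measurable[OF n proposal_measurable[OF n] coord_measurable[OF n] Gm])
  have Rb: "\<bar>A h * mh n (proposal E \<nu> q h n (Suc i)) G (h (n, i))\<bar> \<le> C * 1" if "h \<in> space T" for h
    using C[OF that] mh_bound[OF n proposal_space[OF n that] G coord_space[OF n that]] .
  have s2: "settled i (n - 1) (\<lambda>h. A h * mh n (proposal E \<nu> q h n (Suc i)) G (h (n, i)))"
    unfolding settled_def
  proof (intro conjI allI impI)
    fix h :: "'a trajectory" and k' i' y assume l: "i' > Suc i \<or> (i' = Suc i \<and> k' > n - 1)"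
    then have "(h((k', i') := y)) (n, i) = h (n, i)" by auto
    then show "A (h((k', i') := y)) * mh n (proposal E \<nu> q (h((k', i') := y)) n (Suc i)) G ((h((k', i') := y)) (n, i))
        = A h * mh n (proposal E \<nu> q h n (Suc i)) G (h (n, i))"
      by (simp only: Ai[OF l] proposal_update_irrelevant[OF l])
  qed (use R Rb in auto)
  have "(\<integral>h. A h * G (h (n, Suc i)) \<partial>law I) = (\<integral>h. A h * G (h (n, Suc i)) \<partial>partial_law i (Suc (n - 1)))"
    using settled_law[OF s1 n1(2) i] by (simp only: n1)
  also have "\<dots> = (\<integral>h. (\<integral>h'. A h' * G (h' (n, Suc i)) \<partial>update_level E \<nu> \<gamma> q P (Suc i) n h) \<partial>partial_law i (n - 1))"
    using n1 by (subst partial_law_Suc)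
      (auto intro!: integral_bind_prob[OF partial_law_space update_level_measurable[OF n] F Fb])
  also have "\<dots> = (\<integral>h. A h * mh n (proposal E \<nu> q h n (Suc i)) G (h (n, i)) \<partial>partial_law i (n - 1))"
  proof (rule Bochner_Integration.integral_cong[OF refl])
    fix h assume "h \<in> space (partial_law i (n - 1))"
    then have h: "h \<in> space T"
      using partial_law_space[of "n - 1" i] n1 by (auto simp: space_prob_algebra dest: sets_eq_imp_space_eq)
    have u: "A (h((n, Suc i) := y)) * G ((h((n, Suc i) := y)) (n, Suc i)) = A h * G y" for y
      using Ai[of "Suc i" n h y] n by auto
    show "(\<integral>h'. A h' * G (h' (n, Suc i)) \<partial>update_level E \<nu> \<gamma> q P (Suc i) n h)
        = A h * mh n (proposal E \<nu> q h n (Suc i)) G (h (n, i))"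
      using integral_update_level[OF n h F Fb u] by simp
  qed
  also have "\<dots> = (\<integral>h. A h * mh n (proposal E \<nu> q h n (Suc i)) G (h (n, i)) \<partial>law I)"
    using settled_law[OF s2 n1(1) i] by simp
  finally show ?thesis .
qed

lemma settled_eval': "n \<in> {1..P} \<Longrightarrow> g \<in> unit_ball (S n) \<Longrightarrow> i \<le> j \<Longrightarrow> settled j k (\<lambda>h. g (h (n, i)))"
  unfolding settled_def
  by (auto intro!: measurable_compose[OF coord_measurable] unit_ball_bound[OF _ coord_space] exI[of _ 1])

lemma supp_measurable: "n \<in> {1..P} \<Longrightarrow> supp n \<in> sets (S n)"
proof -
  assume n: "n \<in> {1..P}"
  then have [measurable]: "\<gamma> n \<in> borel_measurable (S n)" by (intro g_meas) auto
  have "supp n = {x \<in> space (S n). \<gamma> n x > 0}" using supp_iff[OF n] by auto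
  also have "\<dots> \<in> sets (S n)" by measurable
  finally show ?thesis .
qed

lemma acc_off_supp: "n \<in> {1..P} \<Longrightarrow> y \<in> space (S n) \<Longrightarrow> y \<notin> supp n \<Longrightarrow> acc n x y = 0"
  by (simp add: accept_prob_def weight_off_supp)

text \<open>Proposals off the support have weight 0 and are never accepted, so the chain cannot
  leave the support in which it starts. In terms of the operator, \<open>mh\<close> maps the
  indicator of the support to 1 at each point of the support.\<close>

lemma AE_supp:
  assumes n: "n \<in> {1..P}" and i: "i \<le> I"
  shows "AE h in law I. h (n, i) \<in> supp n"
proof -
  interpret prob_space "law I" by (rule prob_law)
  define G :: "(nat \<Rightarrow> 'a) \<Rightarrow> real" where "G = indicator (supp n)"
  have G: "G \<in> unit_ball (S n)"
    unfolding G_def using supp_measurable[OF n] by (intro unit_ballI) (auto simp: indicator_def)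
  have mhG: "mh n p G x = 1" if "p \<in> space (prob_algebra (S n))" "x \<in> supp n" for p x
  proof -
    have "space p = space (S n)" using that by (auto simp: space_prob_algebra dest: sets_eq_imp_space_eq)
    then have "(\<integral>y. acc n x y * (G y - G x) \<partial>p) = (\<integral>y. 0 \<partial>p)"
      using that(2) by (intro Bochner_Integration.integral_cong) (auto simp: G_def indicator_def acc_off_supp[OF n])
    then show ?thesis using that(2) by (simp add: mh_def G_def)
  qed
  have AE: "AE h in law I. h (n, j) \<in> supp n" if "(\<integral>h. G (h (n, j)) \<partial>law I) = 1" for j
  proof -
    let ?B = "{h \<in> space (law I). h (n, j) \<in> supp n}"
    have B: "?B \<in> events"
      using measurable_sets[OF coord_measurable[OF n, of j] supp_measurable[OF n]]
      by (simp add: vimage_def Int_def conj_commute)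
    have "(\<integral>h. G (h (n, j)) \<partial>law I) = (\<integral>h. indicator ?B h \<partial>law I)"
      by (intro Bochner_Integration.integral_cong) (auto simp: G_def indicator_def)
    also have "\<dots> = prob ?B" using B by simp
    finally have "prob ?B = 1" using that by simp
    then show ?thesis using prob_Collect_eq_1[OF B] by simp
  qed
  show ?thesis
    using i
  proof (induction i)
    case 0
    have "(\<integral>h. G (h (n, 0)) \<partial>law I) = (\<integral>h. G (h (n, 0)) \<partial>law 0)"
    proof (cases I)
      case (Suc j)
      then show ?thesis
        using settled_law[OF settled_eval'[OF n G, of 0 0 0], of I] partial_law_0[of 0] by simp
    qed simp
    also have "\<dots> = G (initial_trajectory P x0 (n, 0))"
      using measurable_compose[OF coord_measurable[OF n] unit_ball_measurable[OF G]]
      by (simp add: integral_return[OF initial_space])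
    also have "\<dots> = 1" using n x0_supp[OF n] by (simp add: initial_trajectory_def G_def)
    finally show ?case by (rule AE)
  next
    case (Suc j)
    have s: "settled j (n - 1) (\<lambda>_. 1)" by (auto simp: settled_def intro!: exI[of _ 1])
    have "(\<integral>h. G (h (n, Suc j)) \<partial>law I) = (\<integral>h. mh n (proposal E \<nu> q h n (Suc j)) G (h (n, j)) \<partial>law I)"
      using markov_property[OF n _ s G, of I] Suc.prems by simp
    also have "\<dots> = (\<integral>h. 1 \<partial>law I)"
    proof (rule integral_cong_AE)
      show "(\<lambda>h. mh n (proposal E \<nu> q h n (Suc j)) G (h (n, j))) \<in> borel_measurable (law I)"
        using mh_measurable[OF n proposal_measurable[OF n] coord_measurable[OF n] unit_ball_measurable[OF G]]
        by (simp cong: measurable_cong_sets)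
      show "AE h in law I. mh n (proposal E \<nu> q h n (Suc j)) G (h (n, j)) = 1"
        using Suc.IH[OF Suc_leD[OF Suc.prems]] AE_space
        by eventually_elim (simp add: mhG proposal_space[OF n])
    qed simp
    also have "\<dots> = 1" using prob_space by simp
    finally show ?case by (rule AE)
  qed
qed

end

section \<open>Null sequences and a grid for the acceptance probability\<close>

lemma tendsto_cesaro_0:
  fixes r :: "nat \<Rightarrow> real"
  assumes r: "r \<longlonglongrightarrow> 0" and nonneg: "\<And>i. 0 \<le> r i"
  shows "(\<lambda>i. (\<Sum>m<i. r m) / real (i + 1)) \<longlonglongrightarrow> 0"
proof (rule LIMSEQ_I)
  fix e :: real assume e: "0 < e"
  obtain N where N: "\<And>m. m \<ge> N \<Longrightarrow> r m < e / 2"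
    using LIMSEQ_D[OF r, of "e / 2"] e nonneg by auto
  define C where "C = (\<Sum>m<N. r m)"
  have "(\<lambda>i. C / real (i + 1)) \<longlonglongrightarrow> 0"
    using LIMSEQ_inverse_real_of_nat[THEN tendsto_mult_left, of C] by (simp add: field_simps)
  from LIMSEQ_D[OF this, of "e / 2"] e obtain M where M: "\<And>i. i \<ge> M \<Longrightarrow> \<bar>C / real (i + 1)\<bar> < e / 2"
    by auto
  have "norm ((\<Sum>m<i. r m) / real (i + 1) - 0) < e" if i: "i \<ge> max M N" for i
  proof -
    have "(\<Sum>m<i. r m) = C + (\<Sum>m\<in>{N..<i}. r m)"
      using i unfolding C_def by (subst sum.union_disjoint[symmetric]) (auto intro!: sum.cong)
    also have "(\<Sum>m\<in>{N..<i}. r m) \<le> (\<Sum>m\<in>{N..<i}. e / 2)"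
      using N by (intro sum_mono) (auto intro: less_imp_le)
    also have "\<dots> \<le> real (i + 1) * (e / 2)"
      using e by (simp only: sum_constant card_atLeastLessThan, intro mult_right_mono) auto
    finally have "(\<Sum>m<i. r m) / real (i + 1) \<le> (C + real (i + 1) * (e / 2)) / real (i + 1)"
      by (intro divide_right_mono) auto
    also have "\<dots> = C / real (i + 1) + e / 2"
      unfolding add_divide_distrib by (subst nonzero_mult_div_cancel_left) auto
    finally have "(\<Sum>m<i. r m) / real (i + 1) \<le> C / real (i + 1) + e / 2" .
    moreover have "C / real (i + 1) < e / 2"
      by (rule le_less_trans[OF abs_ge_self M]) (use i in simp)
    moreover have "0 \<le> (\<Sum>m<i. r m) / real (i + 1)" using nonneg by (intro divide_nonneg_nonneg sum_nonneg) auto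
    ultimately show ?thesis unfolding real_norm_def diff_zero by linarith
  qed
  then show "\<exists>no. \<forall>i\<ge>no. norm ((\<Sum>m<i. r m) / real (i + 1) - 0) < e" by blast
qed

text \<open>For estimates in which an accuracy \<open>e\<close> is fixed first and the null sequence
  \<open>v\<close> depends on it.\<close>

lemma tendsto_0_if_le_approx:
  fixes u :: "nat \<Rightarrow> real"
  assumes "\<And>i. 0 \<le> u i"
    and "\<And>e. e > 0 \<Longrightarrow> \<exists>v. v \<longlonglongrightarrow> 0 \<and> (\<forall>i. u i \<le> e + v i)"
  shows "u \<longlonglongrightarrow> 0"
proof (rule LIMSEQ_I)
  fix e :: real assume e: "0 < e"
  obtain v where v: "v \<longlonglongrightarrow> 0" "\<forall>i. u i \<le> e / 2 + v i" using assms(2)[of "e / 2"] e by auto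
  obtain N where N: "\<And>i. i \<ge> N \<Longrightarrow> \<bar>v i\<bar> < e / 2" using LIMSEQ_D[OF v(1), of "e / 2"] e by auto
  have "norm (u i - 0) < e" if "i \<ge> N" for i
    using N[OF that] v(2)[rule_format, of i] assms(1)[of i] by simp
  then show "\<exists>no. \<forall>i\<ge>no. norm (u i - 0) < e" by blast
qed

text \<open>
  As a function of \<open>w\<close>, the acceptance probability \<open>min 1 (w / t)\<close> depends on \<open>t\<close>
  uniformly continuously only away from \<open>t = 0\<close>, where it tends to the indicator of \<open>w > 0\<close>;
  this costs the exceptional set \<open>0 < w < d\<close>.
\<close>
definition grid_fun :: "real \<Rightarrow> nat \<Rightarrow> real \<Rightarrow> real" where
  "grid_fun s j w = (if j = 0 then (if w > 0 then 1 else 0) else min 1 (w / (real j * s)))"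

text \<open>For \<open>t < d\<close> index 0 is taken: outside \<open>0 < w < d\<close> the two
  functions agree. For \<open>t \<ge> d\<close>, \<open>t\<close> is rounded up to a multiple
  \<open>r\<close> of \<open>e * d\<close>, with relative error \<open>(r - t) / r \<le> e\<close>.
  The number of grid points depends on \<open>B\<close>, \<open>d\<close> and \<open>e\<close>
  alone.\<close>

lemma grid_fun_approx:
  assumes t: "0 < t" "t \<le> B" and d: "0 < d" and e: "0 < e"
  shows "\<exists>j\<le>nat \<lceil>B / (e * d)\<rceil>. \<forall>w\<ge>0. \<bar>min 1 (w / t) - grid_fun (e * d) j w\<bar> \<le> e + (if 0 < w \<and> w < d then 1 else 0)"
proof (cases "t < d")
  case True
  have "\<bar>min 1 (w / t) - grid_fun (e * d) 0 w\<bar> \<le> e + (if 0 < w \<and> w < d then 1 else 0)" if w: "w \<ge> 0" for w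
  proof -
    consider "w = 0" | "0 < w" "w < d" | "w \<ge> d" using w by linarith
    then show ?thesis
    proof cases
      case 2
      then have "0 \<le> w / t" using t by simp
      then show ?thesis using 2 e by (auto simp: grid_fun_def min_def)
    next
      case 3
      then have "1 \<le> w / t" using True t by (simp add: field_simps)
      then show ?thesis using 3 d e by (auto simp: grid_fun_def)
    qed (use e in \<open>auto simp: grid_fun_def\<close>)
  qed
  then show ?thesis by blast
next
  case False
  define s where "s = e * d"
  have s: "s > 0" using d e by (simp add: s_def)
  define j where "j = nat \<lceil>t / s\<rceil>"
  have "t / s > 0" using t s by simp
  \<comment> \<open>Index 0 is reserved for the limit of small \<open>t\<close>, so the rounded
    multiple must have a positive index.\<close>
  then have j0: "j > 0" by (simp add: j_def)
  have jr: "real j = of_int \<lceil>t / s\<rceil>" using \<open>t / s > 0\<close> by (simp add: j_def)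
  have "t / s \<le> real j" "real j < t / s + 1" unfolding jr by linarith+
  then have js: "t \<le> real j * s" "real j * s < t + s" using s by (simp_all add: field_simps)
  define r where "r = real j * s"
  have r: "t \<le> r" "r < t + s" "r > 0" using js t by (auto simp: r_def)
  have "j \<le> nat \<lceil>B / s\<rceil>" unfolding j_def
    using t s by (intro nat_mono ceiling_mono divide_right_mono) auto
  moreover have "\<bar>min 1 (w / t) - grid_fun s j w\<bar> \<le> e + (if 0 < w \<and> w < d then 1 else 0)" if w: "w \<ge> 0" for w
  proof -
    have g: "grid_fun s j w = min 1 (w / r)" using j0 by (simp add: grid_fun_def r_def)
    have sr: "(r - t) / r \<le> e"
    proof -
      have "r - t \<le> e * d" using r by (simp add: s_def)
      also have "\<dots> \<le> e * r" using False r e by (intro mult_left_mono) auto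
      finally show ?thesis using r by (simp add: field_simps)
    qed
    have le: "w / r \<le> w / t" using w r t by (intro divide_left_mono) auto
    \<comment> \<open>The gap between the two truncated lines is widest at \<open>w = t\<close>,
      where it equals \<open>(r - t) / r\<close>.\<close>
    have "min 1 (w / t) - min 1 (w / r) \<le> (r - t) / r"
    proof (cases "w \<le> t")
      case True
      then have "w / t \<le> 1" using t by simp
      then have "min 1 (w / t) - min 1 (w / r) = w / t - w / r" using le by simp
      also have "\<dots> = (w / t) * ((r - t) / r)" using t r by (simp add: field_simps)
      also have "\<dots> \<le> 1 * ((r - t) / r)" using \<open>w / t \<le> 1\<close> r by (intro mult_right_mono) auto
      finally show ?thesis by simp
    next
      case False
      have "t / r \<le> min 1 (w / r)" using False r t by (auto simp: divide_right_mono)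
      moreover have "(r - t) / r = 1 - t / r" using r by (simp add: field_simps)
      ultimately show ?thesis by (simp add: min_def split: if_splits)
    qed
    moreover have "min 1 (w / r) \<le> min 1 (w / t)" using le by (simp add: min_def)
    ultimately show ?thesis unfolding g using sr by auto
  qed
  ultimately show ?thesis unfolding s_def by blast
qed

lemma grid_fun_bound: "0 \<le> w \<Longrightarrow> 0 \<le> s \<Longrightarrow> \<bar>grid_fun s j w\<bar> \<le> 1"
  by (auto simp: grid_fun_def min_def)

lemma grid_fun_measurable[measurable]: "grid_fun s j \<in> borel_measurable borel"
  unfolding grid_fun_def by measurable

section \<open>Finite test classes for Metropolis-Hastings kernels\<close>

context simcmc_setup
begin

declare simcmc.simps(2) [simp del]

text \<open>The sets \<open>0 < wt n y < 1 / (k + 1)\<close> shrink to the empty set, so dominated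
  convergence applies; leaving out weight 0, which \<open>eta n\<close> may charge, is essential
  here.\<close>

lemma small_weight_set:
  assumes n: "n \<in> {1..P}" and e: "e > 0"
  obtains d where "d > 0" "(\<integral>y. (if 0 < wt n y \<and> wt n y < d then 1 else 0) \<partial>eta n) \<le> (e::real)"
proof -
  interpret prob_space "eta n" using prob_eta[OF n] .
  have [measurable]: "wt n \<in> borel_measurable (eta n)"
    using wt_measurable[OF n] by (simp cong: measurable_cong_sets add: sets_eta[OF n])
  let ?b = "\<lambda>k y. (if 0 < wt n y \<and> wt n y < 1 / real (Suc k) then 1 else 0) :: real"
  have lim: "(\<lambda>k. ?b k y) \<longlonglongrightarrow> 0" for y
  proof (cases "wt n y > 0")
    case True
    have "eventually (\<lambda>k. 1 / real (Suc k) < wt n y) sequentially"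
      using order_tendstoD(2)[OF LIMSEQ_inverse_real_of_nat True] by (simp add: field_simps)
    then have "eventually (\<lambda>k. ?b k y = 0) sequentially" by eventually_elim auto
    then show ?thesis by (rule tendsto_eventually)
  qed simp
  have "(\<lambda>k. \<integral>y. ?b k y \<partial>eta n) \<longlonglongrightarrow> (\<integral>y. 0 \<partial>eta n)"
  proof (rule integral_dominated_convergence[where w="\<lambda>_. 1"])
    show "AE y in eta n. (\<lambda>k. ?b k y) \<longlonglongrightarrow> 0" using lim by auto
  qed auto
  then have "(\<lambda>k. \<integral>y. ?b k y \<partial>eta n) \<longlonglongrightarrow> 0" by simp
  from order_tendstoD(2)[OF this e] obtain k where "(\<integral>y. ?b k y \<partial>eta n) < e"
    by (auto simp: eventually_sequentially)
  then show ?thesis by (intro that[of "1 / real (Suc k)"]) auto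
qed

text \<open>\<open>acc n x\<close> depends on \<open>x\<close> only through \<open>wt n x\<close>,
  which lies in \<open>(0, B]\<close>, so finitely many grid functions approximate all of them. The
  class \<open>\<Phi>\<close> depends on \<open>g\<close> and \<open>e\<close> but neither on
  \<open>p\<close> nor on \<open>x\<close>, as a random proposal and a random state require.\<close>

lemma mh_approx:
  assumes n: "n \<in> {1..P}" and g: "g \<in> unit_ball (S n)" and e: "e > 0"
  shows "\<exists>\<Phi>. finite \<Phi> \<and> \<Phi> \<subseteq> unit_ball (S n) \<and> (\<forall>p\<in>space (prob_algebra (S n)). \<forall>x\<in>supp n.
     \<bar>mh n p g x - K n g x\<bar> \<le> e + 4 * (\<Sum>\<phi>\<in>\<Phi>. \<bar>(\<integral>y. \<phi> y \<partial>p) - (\<integral>y. \<phi> y \<partial>eta n)\<bar>))"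
proof -
  \<comment> \<open>Two integrals, of \<open>acc n x y * g y\<close> and of
    \<open>acc n x y\<close>, each cost \<open>4 * e'\<close>.\<close>
  define e' where "e' = e / 8"
  have e': "e' > 0" using e by (simp add: e'_def)
  obtain B where B: "B > 0" "\<forall>x\<in>space (S n). wt n x \<le> B" using wt_bound_all[OF n] by blast
  obtain d where d: "d > 0" "(\<integral>y. (if 0 < wt n y \<and> wt n y < d then 1 else 0) \<partial>eta n) \<le> e'"
    by (rule small_weight_set[OF n e'])
  define b :: "(nat \<Rightarrow> 'a) \<Rightarrow> real" where "b y = (if 0 < wt n y \<and> wt n y < d then 1 else 0)" for y
  define a where "a j y = grid_fun (e' * d) j (wt n y)" for j y
  define J where "J = nat \<lceil>B / (e' * d)\<rceil>"
  \<comment> \<open>\<open>b\<close> belongs to the class because the exceptional set is known to be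
    small under \<open>eta n\<close> only; its mass under \<open>p\<close> is compared with that
    one.\<close>
  define \<Phi> where "\<Phi> = insert b ((\<lambda>j y. a j y * g y) ` {..J} \<union> a ` {..J})"
  have wm[measurable]: "wt n \<in> borel_measurable (S n)" using n by (rule wt_measurable)
  have bu: "b \<in> unit_ball (S n)" by (rule unit_ballI) (auto simp: b_def[abs_def])
  have au: "a j \<in> unit_ball (S n)" for j
    unfolding a_def using grid_fun_bound[OF wt_nonneg, of "e' * d"] e' d by (intro unit_ballI) auto
  have fin: "finite \<Phi>" by (simp add: \<Phi>_def)
  have sub: "\<Phi> \<subseteq> unit_ball (S n)" using bu au unit_ball_mult[OF au g] by (auto simp: \<Phi>_def)
  have "\<bar>mh n p g x - K n g x\<bar> \<le> e + 4 * (\<Sum>\<phi>\<in>\<Phi>. \<bar>(\<integral>y. \<phi> y \<partial>p) - (\<integral>y. \<phi> y \<partial>eta n)\<bar>)"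
    if p: "p \<in> space (prob_algebra (S n))" and x: "x \<in> supp n" for p x
  proof -
    define \<Delta> where "\<Delta> \<phi> = (\<integral>y. \<phi> y \<partial>p) - (\<integral>y. \<phi> y \<partial>eta n)" for \<phi> :: "(nat \<Rightarrow> 'a) \<Rightarrow> real"
    define \<Sigma> where "\<Sigma> = (\<Sum>\<phi>\<in>\<Phi>. \<bar>\<Delta> \<phi>\<bar>)"
    have \<Delta>_le: "\<bar>\<Delta> \<phi>\<bar> \<le> \<Sigma>" if "\<phi> \<in> \<Phi>" for \<phi>
      unfolding \<Sigma>_def using that fin by (intro member_le_sum) auto
    have xs: "x \<in> space (S n)" using x by (rule supp_space)
    have \<alpha>u: "acc n x \<in> unit_ball (S n)"
    proof (rule unit_ballI)
      show "acc n x \<in> borel_measurable (S n)" by (rule acc_measurable[OF n]) (use xs in auto)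
      show "\<bar>acc n x y\<bar> \<le> 1" for y using acc_bounds[of n x y] by simp
    qed
    have eta: "eta n \<in> space (prob_algebra (S n))" using eta_space[OF n] .
    obtain j where j: "j \<le> J" and ja: "\<forall>w\<ge>0. \<bar>min 1 (w / wt n x) - grid_fun (e' * d) j w\<bar> \<le> e' + (if 0 < w \<and> w < d then 1 else 0)"
      using grid_fun_approx[OF wt_pos[OF n x] bspec[OF B(2) xs] d(1) e'] unfolding J_def by blast
    have app: "\<bar>acc n x y - a j y\<bar> \<le> e' + b y" if "y \<in> space (S n)" for y
      using ja[rule_format, OF wt_nonneg, of n y] by (simp add: acc_eq[OF n x that] a_def b_def)
    have ind: "\<bar>(\<integral>y. acc n x y * \<phi> y \<partial>m) - (\<integral>y. a j y * \<phi> y \<partial>m)\<bar> \<le> e' + (\<integral>y. b y \<partial>m)"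
      if m: "m \<in> space (prob_algebra (S n))" and \<phi>: "\<phi> \<in> unit_ball (S n)" for m \<phi>
    proof -
      have sm: "sets m = sets (S n)" and "prob_space m" using m by (auto simp: space_prob_algebra)
      interpret prob_space m by fact
      note U = unit_ball_cong[OF sm]
      have i: "integrable m (\<lambda>y. acc n x y * \<phi> y)" "integrable m (\<lambda>y. a j y * \<phi> y)" "integrable m b"
        using unit_ball_mult[OF \<alpha>u \<phi>] unit_ball_mult[OF au[of j] \<phi>] bu
        by (auto intro!: integrable_unit_ball simp: U)
      have "\<bar>(\<integral>y. acc n x y * \<phi> y \<partial>m) - (\<integral>y. a j y * \<phi> y \<partial>m)\<bar> = \<bar>\<integral>y. acc n x y * \<phi> y - a j y * \<phi> y \<partial>m\<bar>"
        using i by simp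
      also have "\<dots> \<le> (\<integral>y. \<bar>acc n x y * \<phi> y - a j y * \<phi> y\<bar> \<partial>m)" by (rule integral_abs_bound)
      also have "\<dots> \<le> (\<integral>y. e' + b y \<partial>m)"
      proof (rule integral_mono)
        fix y assume "y \<in> space m"
        then have y: "y \<in> space (S n)" using sets_eq_imp_space_eq[OF sm] by simp
        have "\<bar>acc n x y * \<phi> y - a j y * \<phi> y\<bar> = \<bar>acc n x y - a j y\<bar> * \<bar>\<phi> y\<bar>"
          by (simp add: abs_mult[symmetric] left_diff_distrib)
        also have "\<dots> \<le> (e' + b y) * 1"
          using app[OF y] unit_ball_bound[OF \<phi> y] e' by (intro mult_mono) (auto simp: b_def)
        finally show "\<bar>acc n x y * \<phi> y - a j y * \<phi> y\<bar> \<le> e' + b y" by simp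
      qed (use i in auto)
      also have "\<dots> = e' + (\<integral>y. b y \<partial>m)" using i by (simp add: prob_space)
      finally show ?thesis .
    qed
    have bd: "(\<integral>y. b y \<partial>eta n) \<le> e'" using d(2) by (simp add: b_def)
    have \<Delta>b: "(\<integral>y. b y \<partial>p) = (\<integral>y. b y \<partial>eta n) + \<Delta> b" by (simp add: \<Delta>_def)
    have bb: "\<bar>\<Delta> b\<bar> \<le> \<Sigma>" by (rule \<Delta>_le) (simp add: \<Phi>_def)
    \<comment> \<open>\<open>ind\<close> is used for \<open>p\<close> and for \<open>eta n\<close>:
      \<open>2 * e'\<close> comes from the grid, at most \<open>2 * e'\<close> from the mass of
      \<open>b\<close> under \<open>eta n\<close> counted twice, and one \<open>\<Sigma>\<close>
      from moving \<open>b\<close> from \<open>p\<close> to \<open>eta n\<close>.\<close>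
    have key: "\<bar>\<Delta> (\<lambda>y. acc n x y * \<phi> y)\<bar> \<le> \<bar>\<Delta> (\<lambda>y. a j y * \<phi> y)\<bar> + 4 * e' + \<Sigma>"
      if "\<phi> \<in> unit_ball (S n)" for \<phi>
      using ind[OF p that] ind[OF eta that] bd \<Delta>b bb unfolding \<Delta>_def by linarith
    have k1: "\<bar>\<Delta> (\<lambda>y. acc n x y * g y)\<bar> \<le> 4 * e' + 2 * \<Sigma>"
      using key[OF g] \<Delta>_le[of "\<lambda>y. a j y * g y"] j by (auto simp: \<Phi>_def)
    have "(\<lambda>_. 1) \<in> unit_ball (S n)" by (rule unit_ballI) auto
    from key[OF this] have k2: "\<bar>\<Delta> (acc n x)\<bar> \<le> 4 * e' + 2 * \<Sigma>"
      using \<Delta>_le[of "a j"] j by (auto simp: \<Phi>_def)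
    have mh: "mh n m g x = g x + (\<integral>y. acc n x y * g y \<partial>m) - g x * (\<integral>y. acc n x y \<partial>m)"
      if m: "m \<in> space (prob_algebra (S n))" for m
    proof -
      have sm: "sets m = sets (S n)" and "prob_space m" using m by (auto simp: space_prob_algebra)
      interpret prob_space m by fact
      note U = unit_ball_cong[OF sm]
      have "integrable m (\<lambda>y. acc n x y * g y)" "integrable m (acc n x)"
        using unit_ball_mult[OF \<alpha>u g] \<alpha>u by (auto intro!: integrable_unit_ball simp: U)
      then show ?thesis by (simp add: mh_def right_diff_distrib mult.commute[of "g x"])
    qed
    have "mh n p g x - K n g x = \<Delta> (\<lambda>y. acc n x y * g y) - g x * \<Delta> (acc n x)"
      unfolding mh[OF p] mh[OF eta] \<Delta>_def by (simp add: algebra_simps)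
    moreover have "\<bar>g x * \<Delta> (acc n x)\<bar> \<le> \<bar>\<Delta> (acc n x)\<bar>"
      using unit_ball_bound[OF g xs] by (simp add: abs_mult mult_left_le_one_le)
    ultimately have "\<bar>mh n p g x - K n g x\<bar> \<le> 8 * e' + 4 * \<Sigma>" using k1 k2 by linarith
    then show ?thesis by (simp add: e'_def \<Sigma>_def \<Delta>_def)
  qed
  with fin sub show ?thesis by blast
qed

subsection \<open>Convergence\<close>

text \<open>Convergence in L^1 for each test function separately. Uniformity over test functions is
  not claimed, which is why the finite classes of \<open>mh_approx\<close> matter.\<close>

definition proposal_converges :: "nat \<Rightarrow> bool" where
  "proposal_converges n \<longleftrightarrow> (\<forall>\<phi>\<in>unit_ball (S n).
     (\<lambda>i. \<integral>h. \<bar>(\<integral>y. \<phi> y \<partial>proposal E \<nu> q h n i) - (\<integral>y. \<phi> y \<partial>eta n)\<bar> \<partial>law i) \<longlonglongrightarrow> 0)"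

text \<open>The state carries time \<open>i\<close> but the proposal time \<open>Suc i\<close>: in
  iteration \<open>i + 1\<close> level \<open>n - 1\<close> has moved before level \<open>n\<close>
  does.\<close>

definition kernel_error :: "nat \<Rightarrow> ((nat \<Rightarrow> 'a) \<Rightarrow> real) \<Rightarrow> nat \<Rightarrow> 'a trajectory \<Rightarrow> real" where
  "kernel_error n g i h = mh n (proposal E \<nu> q h n (Suc i)) g (h (n, i)) - K n g (h (n, i))"

lemma law_integrable: "F \<in> borel_measurable T \<Longrightarrow> (\<And>h. h \<in> space T \<Longrightarrow> \<bar>F h\<bar> \<le> C) \<Longrightarrow> integrable (law I) (F :: _ \<Rightarrow> real)"
  by (rule prob_space.integrable_bounded[OF prob_law, where B=C]) (auto cong: measurable_cong_sets)

lemma kernel_error_measurable: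
  assumes n: "n \<in> {1..P}" and g: "g \<in> unit_ball (S n)"
  shows "kernel_error n g i \<in> borel_measurable T"
  unfolding kernel_error_def
  by (intro borel_measurable_diff mh_measurable[OF n proposal_measurable[OF n] coord_measurable[OF n]]
      mh_measurable[OF n _ coord_measurable[OF n]] measurable_const eta_space[OF n]) (use g in auto)

lemma kernel_error_bound:
  assumes n: "n \<in> {1..P}" and g: "g \<in> unit_ball (S n)" and h: "h \<in> space T"
  shows "\<bar>kernel_error n g i h\<bar> \<le> 2"
  using mh_bound[OF n proposal_space[OF n h, of "Suc i"] g coord_space[OF n h, of i]]
    mh_bound[OF n eta_space[OF n] g coord_space[OF n h, of i]]
  unfolding kernel_error_def by linarith

lemma kernel_error_update:
  "i' > Suc i \<or> (i' = Suc i \<and> k' > n - 1) \<Longrightarrow> kernel_error n g i (h((k', i') := y)) = kernel_error n g i h"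
  by (auto simp: kernel_error_def proposal_update_irrelevant)

text \<open>\<open>mh_approx\<close> is applied pointwise along the chain, which stays in the
  support almost surely; the finite sum over \<open>\<Phi>\<close> vanishes term by term, and
  \<open>e\<close> is sent to 0 last.\<close>

lemma kernel_error_tendsto:
  assumes n: "n \<in> {1..P}" and g: "g \<in> unit_ball (S n)" and pc: "proposal_converges n"
  shows "(\<lambda>i. \<integral>h. \<bar>kernel_error n g i h\<bar> \<partial>law (Suc i)) \<longlonglongrightarrow> 0"
proof (rule tendsto_0_if_le_approx)
  fix e :: real assume "e > 0"
  from mh_approx[OF n g this] obtain \<Phi> where fin: "finite \<Phi>" and sub: "\<Phi> \<subseteq> unit_ball (S n)"
    and le: "\<forall>p\<in>space (prob_algebra (S n)). \<forall>x\<in>supp n.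
     \<bar>mh n p g x - K n g x\<bar> \<le> e + 4 * (\<Sum>\<phi>\<in>\<Phi>. \<bar>(\<integral>y. \<phi> y \<partial>p) - (\<integral>y. \<phi> y \<partial>eta n)\<bar>)" by blast
  define D where "D \<phi> i h = \<bar>(\<integral>y. \<phi> y \<partial>proposal E \<nu> q h n i) - (\<integral>y. \<phi> y \<partial>eta n)\<bar>" for \<phi> :: "(nat \<Rightarrow> 'a) \<Rightarrow> real" and i h
  have int: "integrable (law I) (D \<phi> i)" if "\<phi> \<in> \<Phi>" for \<phi> i I
  proof (rule law_integrable[where C=2])
    have \<phi>: "\<phi> \<in> unit_ball (S n)" using that sub by auto
    show "D \<phi> i \<in> borel_measurable T"
      unfolding D_def using \<phi>
      by (intro borel_measurable_abs borel_measurable_diff borel_measurable_const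
          measurable_compose[OF measurable_prob_algebraD[OF proposal_measurable[OF n]] integral_measurable_subprob_algebra]) auto
    have b: "\<bar>\<integral>y. \<phi> y \<partial>p\<bar> \<le> 1" if "p \<in> space (prob_algebra (S n))" for p
    proof -
      have "sets p = sets (S n)" "prob_space p" using that by (auto simp: space_prob_algebra)
      then show ?thesis using \<phi> unit_ball_cong[of p "S n"]
        by (intro prob_space.abs_integral_le) (auto dest: unit_ball_bound)
    qed
    fix h assume "h \<in> space T"
    from b[OF proposal_space[OF n this, of i]] b[OF eta_space[OF n]] show "\<bar>D \<phi> i h\<bar> \<le> 2"
      unfolding D_def by linarith
  qed
  have "(\<lambda>i. \<integral>h. D \<phi> (Suc i) h \<partial>law (Suc i)) \<longlonglongrightarrow> 0" if "\<phi> \<in> \<Phi>" for \<phi>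
    using pc sub that unfolding proposal_converges_def D_def by (intro LIMSEQ_Suc) auto
  then have "(\<lambda>i. 4 * (\<Sum>\<phi>\<in>\<Phi>. \<integral>h. D \<phi> (Suc i) h \<partial>law (Suc i))) \<longlonglongrightarrow> 4 * (\<Sum>\<phi>\<in>\<Phi>. 0)"
    by (intro tendsto_mult_left tendsto_sum) auto
  moreover have "(\<integral>h. \<bar>kernel_error n g i h\<bar> \<partial>law (Suc i)) \<le> e + 4 * (\<Sum>\<phi>\<in>\<Phi>. \<integral>h. D \<phi> (Suc i) h \<partial>law (Suc i))" for i
  proof -
    interpret prob_space "law (Suc i)" by (rule prob_law)
    have "(\<integral>h. \<bar>kernel_error n g i h\<bar> \<partial>law (Suc i)) \<le> (\<integral>h. e + 4 * (\<Sum>\<phi>\<in>\<Phi>. D \<phi> (Suc i) h) \<partial>law (Suc i))"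
    proof (rule integral_mono_AE)
      show "integrable (law (Suc i)) (\<lambda>h. \<bar>kernel_error n g i h\<bar>)"
        by (intro integrable_abs law_integrable[OF kernel_error_measurable[OF n g] kernel_error_bound[OF n g]])
      show "integrable (law (Suc i)) (\<lambda>h. e + 4 * (\<Sum>\<phi>\<in>\<Phi>. D \<phi> (Suc i) h))" using int by auto
      have "i \<le> Suc i" by simp
      from AE_supp[OF n this] AE_space
      show "AE h in law (Suc i). \<bar>kernel_error n g i h\<bar> \<le> e + 4 * (\<Sum>\<phi>\<in>\<Phi>. D \<phi> (Suc i) h)"
      proof eventually_elim
        case (elim h)
        then have "h \<in> space T" by simp
        from le[rule_format, OF proposal_space[OF n this] elim(1)]
        show ?case unfolding D_def kernel_error_def .
      qed
    qed
    also have "\<dots> = e + 4 * (\<Sum>\<phi>\<in>\<Phi>. \<integral>h. D \<phi> (Suc i) h \<partial>law (Suc i))"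
      using int prob_space by simp
    finally show ?thesis .
  qed
  ultimately show "\<exists>v. v \<longlonglongrightarrow> 0 \<and> (\<forall>i. (\<integral>h. \<bar>kernel_error n g i h\<bar> \<partial>law (Suc i)) \<le> e + v i)"
    by (intro exI[of _ "\<lambda>i. 4 * (\<Sum>\<phi>\<in>\<Phi>. \<integral>h. D \<phi> (Suc i) h \<partial>law (Suc i))"]) simp
qed simp


lemma law_settled_eq:
  assumes F: "settled i k F" and k: "k \<le> P" and I: "i < I" "i < I'"
  shows "(\<integral>h. F h \<partial>law I) = (\<integral>h. F h \<partial>law I')"
  using settled_law[OF F k I(1)] settled_law[OF F k I(2)] by simp

lemma law_settled_0:
  assumes F: "settled i 0 F" and I: "i \<le> I"
  shows "(\<integral>h. F h \<partial>law I) = (\<integral>h. F h \<partial>law i)"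
proof (cases "i = I")
  case False
  then show ?thesis using settled_law[OF F _, of I] I by (simp add: partial_law_0)
qed simp

lemma kernel_error_settled:
  assumes n: "n \<in> {1..P}" and g: "g \<in> unit_ball (S n)"
  shows "settled i (n - 1) (\<lambda>h. \<bar>kernel_error n g i h\<bar>)"
  unfolding settled_def
  using kernel_error_measurable[OF n g, of i] kernel_error_bound[OF n g, of _ i]
  by (auto simp: kernel_error_update)

section \<open>Martingale part of the averages\<close>

definition mart_diff :: "nat \<Rightarrow> ((nat \<Rightarrow> 'a) \<Rightarrow> real) \<Rightarrow> nat \<Rightarrow> 'a trajectory \<Rightarrow> real" where
  "mart_diff n g i h = g (h (n, Suc i)) - mh n (proposal E \<nu> q h n (Suc i)) g (h (n, i))"

lemma mart_diff_measurable:
  assumes n: "n \<in> {1..P}" and g: "g \<in> unit_ball (S n)"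
  shows "mart_diff n g i \<in> borel_measurable T"
  unfolding mart_diff_def
  by (intro borel_measurable_diff mh_measurable[OF n proposal_measurable[OF n] coord_measurable[OF n]]
      measurable_compose[OF coord_measurable[OF n]]) (use g in auto)

lemma mart_diff_bound:
  assumes n: "n \<in> {1..P}" and g: "g \<in> unit_ball (S n)" and h: "h \<in> space T"
  shows "\<bar>mart_diff n g i h\<bar> \<le> 2"
  using mh_bound[OF n proposal_space[OF n h, of "Suc i"] g coord_space[OF n h, of i]]
    unit_ball_bound[OF g coord_space[OF n h, of "Suc i"]]
  unfolding mart_diff_def by linarith

lemma mart_diff_update: "i' > Suc i \<Longrightarrow> mart_diff n g i (h((k', i') := y)) = mart_diff n g i h"
  by (auto simp: mart_diff_def proposal_update_irrelevant)

definition mart :: "nat \<Rightarrow> ((nat \<Rightarrow> 'a) \<Rightarrow> real) \<Rightarrow> nat \<Rightarrow> 'a trajectory \<Rightarrow> real" where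
  "mart n g i h = (\<Sum>m<i. mart_diff n g m h)"

lemma mart_measurable:
  assumes n: "n \<in> {1..P}" and g: "g \<in> unit_ball (S n)"
  shows "mart n g i \<in> borel_measurable T"
  unfolding mart_def using mart_diff_measurable[OF assms] by (intro borel_measurable_sum) auto

lemma mart_bound:
  assumes n: "n \<in> {1..P}" and g: "g \<in> unit_ball (S n)" and h: "h \<in> space T"
  shows "\<bar>mart n g i h\<bar> \<le> 2 * real i"
proof -
  have "\<bar>mart n g i h\<bar> \<le> (\<Sum>m<i. \<bar>mart_diff n g m h\<bar>)" unfolding mart_def by (rule sum_abs)
  also have "\<dots> \<le> (\<Sum>m<i. 2)" by (intro sum_mono mart_diff_bound assms)
  finally show ?thesis by simp
qed

lemma mart_settled:
  assumes n: "n \<in> {1..P}" and g: "g \<in> unit_ball (S n)"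
  shows "settled i k (mart n g i)"
  unfolding settled_def
proof (intro conjI allI impI)
  show "\<exists>C. \<forall>h\<in>space T. \<bar>mart n g i h\<bar> \<le> C" using mart_bound[OF n g] by blast
  fix h :: "'a trajectory" and k' i' y
  assume "i' > Suc i \<or> (i' = Suc i \<and> k' > k)"
  then show "mart n g i (h((k', i') := y)) = mart n g i h"
    unfolding mart_def by (intro sum.cong refl mart_diff_update) auto
qed (rule mart_measurable[OF n g])

text \<open>Martingale differences are orthogonal: by \<open>markov_property\<close> with the
  settled factor \<open>mart n g i\<close> the cross term vanishes, and each squared difference is
  at most 4.\<close>

lemma mart_second_moment:
  assumes n: "n \<in> {1..P}" and g: "g \<in> unit_ball (S n)" and i: "i \<le> I"
  shows "(\<integral>h. (mart n g i h)\<^sup>2 \<partial>law I) \<le> 4 * real i"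
  using i
proof (induction i)
  case 0
  then show ?case by (simp add: mart_def)
next
  case (Suc i)
  interpret prob_space "law I" by (rule prob_law)
  let ?S = "mart n g i" and ?D = "mart_diff n g i"
  note Sm = mart_measurable[OF n g, of i] and Dm = mart_diff_measurable[OF n g, of i]
  note Sb = mart_bound[OF n g, of _ i] and Db = mart_diff_bound[OF n g, of _ i]
  have i1: "integrable (law I) (\<lambda>h. (?S h)\<^sup>2)"
    using power_mono[OF Sb abs_ge_zero, of _ 2] Sm by (intro law_integrable[where C="(2 * real i)\<^sup>2"]) auto
  have i2: "integrable (law I) (\<lambda>h. (?D h)\<^sup>2)"
    using power_mono[OF Db abs_ge_zero, of _ 2] Dm by (intro law_integrable[where C="2\<^sup>2"]) auto
  have SF: "integrable (law I) (\<lambda>h. ?S h * F h)" if "F \<in> borel_measurable T" "\<And>h. h \<in> space T \<Longrightarrow> \<bar>F h\<bar> \<le> C" for F C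
  proof (rule law_integrable[where C="2 * real i * C"])
    fix h assume h: "h \<in> space T"
    show "\<bar>?S h * F h\<bar> \<le> 2 * real i * C"
      unfolding abs_mult using Sb[OF h] that(2)[OF h] by (intro mult_mono) auto
  qed (use Sm that(1) in auto)
  have i3: "integrable (law I) (\<lambda>h. ?S h * ?D h)" by (rule SF[OF Dm Db])
  have "(\<integral>h. ?S h * g (h (n, Suc i)) \<partial>law I)
      = (\<integral>h. ?S h * mh n (proposal E \<nu> q h n (Suc i)) g (h (n, i)) \<partial>law I)"
    by (rule markov_property[OF n _ mart_settled[OF n g] g]) (use Suc.prems in simp)
  moreover have "integrable (law I) (\<lambda>h. ?S h * g (h (n, Suc i)))"
    using measurable_compose[OF coord_measurable[OF n] unit_ball_measurable[OF g]]
      unit_ball_bound[OF g coord_space[OF n]] by (rule SF)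
  moreover have "integrable (law I) (\<lambda>h. ?S h * mh n (proposal E \<nu> q h n (Suc i)) g (h (n, i)))"
    using mh_measurable[OF n proposal_measurable[OF n] coord_measurable[OF n] unit_ball_measurable[OF g]]
      mh_bound[OF n proposal_space[OF n] g coord_space[OF n]] by (rule SF)
  ultimately have 0: "(\<integral>h. ?S h * ?D h \<partial>law I) = 0"
    by (simp add: mart_diff_def right_diff_distrib)
  have "(\<integral>h. (?D h)\<^sup>2 \<partial>law I) \<le> 4"
  proof (rule integral_le_const[OF i2], rule AE_I2)
    fix h assume "h \<in> space (law I)"
    then show "(?D h)\<^sup>2 \<le> 4" using power_mono[OF Db abs_ge_zero, of h 2] by simp
  qed
  moreover have "(\<integral>h. (mart n g (Suc i) h)\<^sup>2 \<partial>law I) = (\<integral>h. (?S h)\<^sup>2 + 2 * (?S h * ?D h) + (?D h)\<^sup>2 \<partial>law I)"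
    by (simp add: mart_def power2_sum algebra_simps)
  moreover have "\<dots> = (\<integral>h. (?S h)\<^sup>2 \<partial>law I) + (\<integral>h. (?D h)\<^sup>2 \<partial>law I)"
    using i1 i2 i3 0 by simp
  ultimately show ?case using Suc by simp
qed

lemma mart_first_moment:
  assumes n: "n \<in> {1..P}" and g: "g \<in> unit_ball (S n)"
  shows "(\<integral>h. \<bar>mart n g i h\<bar> \<partial>law i) \<le> 5 / 2 * sqrt (real (i + 1))"
proof -
  interpret prob_space "law i" by (rule prob_law)
  define c where "c = sqrt (real (i + 1))"
  have c: "c > 0" "c\<^sup>2 = real (i + 1)" by (simp_all add: c_def)
  note Sm = mart_measurable[OF n g, of i] and Sb = mart_bound[OF n g, of _ i]
  have i1: "integrable (law i) (\<lambda>h. (mart n g i h)\<^sup>2)"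
    using power_mono[OF Sb abs_ge_zero, of _ 2] Sm by (intro law_integrable[where C="(2 * real i)\<^sup>2"]) auto
  have i2: "integrable (law i) (\<lambda>h. \<bar>mart n g i h\<bar>)"
    using Sm Sb by (intro integrable_abs law_integrable) auto
  \<comment> \<open>The arithmetic-geometric mean inequality takes the place of Cauchy-Schwarz. With
    \<open>c\<^sup>2 = i + 1\<close> the second moment gives \<open>(4 * c + c) / 2\<close>; the
    \<open>+ 1\<close> keeps \<open>c\<close> positive at \<open>i = 0\<close>.\<close>
  have am: "\<bar>s\<bar> \<le> (s\<^sup>2 / c + c) / 2" for s :: real
  proof -
    have "0 \<le> (\<bar>s\<bar> - c)\<^sup>2 / c" using c by simp
    also have "\<dots> = s\<^sup>2 / c + c - 2 * \<bar>s\<bar>" using c(1) by (simp add: power2_diff field_simps power2_eq_square)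
    finally show ?thesis by simp
  qed
  have "(\<integral>h. \<bar>mart n g i h\<bar> \<partial>law i) \<le> (\<integral>h. ((mart n g i h)\<^sup>2 / c + c) / 2 \<partial>law i)"
    using i1 i2 am by (intro integral_mono) auto
  also have "\<dots> = ((\<integral>h. (mart n g i h)\<^sup>2 \<partial>law i) / c + c) / 2"
    using i1 prob_space by simp
  also have "\<dots> \<le> (4 * c\<^sup>2 / c + c) / 2"
    using mart_second_moment[OF n g order_refl, of i] c
    by (intro divide_right_mono add_right_mono) auto
  also have "\<dots> = 5 / 2 * c" using c(1) by (simp add: power2_eq_square)
  finally show ?thesis by (simp add: c_def)
qed

text \<open>The sum splits into two boundary terms, a martingale and a sum of kernel errors. Divided
  by \<open>i + 1\<close>, the first two contributions are of order 1/i and 1/sqrt(i), and the third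
  is a Cesaro mean of a null sequence.\<close>

lemma ergodic_coboundary:
  assumes n: "n \<in> {1..P}" and g: "g \<in> unit_ball (S n)" and pc: "proposal_converges n"
  shows "(\<lambda>i. \<integral>h. \<bar>(\<Sum>m\<le>i. g (h (n, m)) - K n g (h (n, m))) / real (i + 1)\<bar> \<partial>law i) \<longlonglongrightarrow> 0"
proof (rule tendsto_sandwich[OF _ _ tendsto_const])
  define r where "r i = (\<integral>h. \<bar>kernel_error n g i h\<bar> \<partial>law (Suc i))" for i
  note Kg = K_unit_ball[OF n g]
  have r: "r \<longlonglongrightarrow> 0" unfolding r_def by (rule kernel_error_tendsto[OF n g pc])
  have 1: "(\<lambda>i. (\<Sum>m<i. r m) / real (i + 1)) \<longlonglongrightarrow> 0"
    by (rule tendsto_cesaro_0[OF r]) (simp add: r_def)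
  have 2: "(\<lambda>i. 2 / real (i + 1) + 5 / 2 * (1 / sqrt (real (i + 1)))) \<longlonglongrightarrow> 0" by real_asymp
  show "(\<lambda>i. 2 / real (i + 1) + 5 / 2 * (1 / sqrt (real (i + 1))) + (\<Sum>m<i. r m) / real (i + 1)) \<longlonglongrightarrow> 0"
    using tendsto_add[OF 2 1] unfolding add_0 .
  have "(\<integral>h. \<bar>(\<Sum>m\<le>i. g (h (n, m)) - K n g (h (n, m))) / real (i + 1)\<bar> \<partial>law i)
      \<le> 2 / real (i + 1) + 5 / 2 * (1 / sqrt (real (i + 1))) + (\<Sum>m<i. r m) / real (i + 1)" for i
  proof -
    interpret prob_space "law i" by (rule prob_law)
    let ?L = "\<lambda>h. \<Sum>m\<le>i. g (h (n, m)) - K n g (h (n, m))"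
    \<comment> \<open>\<open>g\<close> at time \<open>m + 1\<close> is paired with
      \<open>K n g\<close> at time \<open>m\<close>; the unpaired ends are \<open>g\<close> at time
      0 and \<open>K n g\<close> at time \<open>i\<close>.\<close>
    have decomp: "?L h = g (h (n, 0)) - K n g (h (n, i)) + mart n g i h + (\<Sum>m<i. kernel_error n g m h)" for h
    proof -
      have "?L h = g (h (n, 0)) - K n g (h (n, i)) + (\<Sum>m<i. g (h (n, Suc m)) - K n g (h (n, m)))"
        by (induction i) simp_all
      also have "(\<Sum>m<i. g (h (n, Suc m)) - K n g (h (n, m))) = mart n g i h + (\<Sum>m<i. kernel_error n g m h)"
        by (simp add: mart_def sum.distrib[symmetric] mart_diff_def kernel_error_def)
      finally show ?thesis by simp
    qed
    have ie: "integrable (law i) (\<lambda>h. \<bar>kernel_error n g m h\<bar>)" for m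
      by (intro integrable_abs law_integrable[OF kernel_error_measurable[OF n g] kernel_error_bound[OF n g]])
    have im: "integrable (law i) (\<lambda>h. \<bar>mart n g i h\<bar>)"
      by (intro integrable_abs law_integrable[OF mart_measurable[OF n g] mart_bound[OF n g]])
    have Lb: "\<bar>?L h\<bar> \<le> 2 + \<bar>mart n g i h\<bar> + (\<Sum>m<i. \<bar>kernel_error n g m h\<bar>)" if h: "h \<in> space T" for h
      using unit_ball_bound[OF g coord_space[OF n h, of 0]] unit_ball_bound[OF Kg coord_space[OF n h, of i]]
        sum_abs[of "\<lambda>m. kernel_error n g m h" "{..<i}"]
      unfolding decomp by linarith
    have iL: "integrable (law i) (\<lambda>h. \<bar>?L h\<bar>)"
    proof (rule Bochner_Integration.integrable_bound)
      show "integrable (law i) (\<lambda>h. 2 + \<bar>mart n g i h\<bar> + (\<Sum>m<i. \<bar>kernel_error n g m h\<bar>))" using ie im by auto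
      have "?L \<in> borel_measurable T"
        by (intro borel_measurable_sum borel_measurable_diff measurable_compose[OF coord_measurable[OF n]]
             unit_ball_measurable[OF g] unit_ball_measurable[OF Kg])
      then show "(\<lambda>h. \<bar>?L h\<bar>) \<in> borel_measurable (law i)" by (simp cong: measurable_cong_sets)
      show "AE h in law i. norm \<bar>?L h\<bar> \<le> norm (2 + \<bar>mart n g i h\<bar> + (\<Sum>m<i. \<bar>kernel_error n g m h\<bar>))"
      proof (rule AE_I2)
        fix h assume "h \<in> space (law i)"
        then have "h \<in> space T" by simp
        from Lb[OF this] show "norm \<bar>?L h\<bar> \<le> norm (2 + \<bar>mart n g i h\<bar> + (\<Sum>m<i. \<bar>kernel_error n g m h\<bar>))"
          by simp
      qed
    qed
    have "(\<integral>h. \<bar>?L h\<bar> \<partial>law i) \<le> (\<integral>h. 2 + \<bar>mart n g i h\<bar> + (\<Sum>m<i. \<bar>kernel_error n g m h\<bar>) \<partial>law i)"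
      using iL ie im Lb by (intro integral_mono) auto
    also have "\<dots> = 2 + (\<integral>h. \<bar>mart n g i h\<bar> \<partial>law i) + (\<Sum>m<i. \<integral>h. \<bar>kernel_error n g m h\<bar> \<partial>law i)"
      using ie im prob_space by simp
    \<comment> \<open>The error at time \<open>m\<close> is settled within iteration
      \<open>m + 1\<close>, so it has the same integral under \<open>law i\<close> as under
      \<open>law (Suc m)\<close>.\<close>
    also have "(\<Sum>m<i. \<integral>h. \<bar>kernel_error n g m h\<bar> \<partial>law i) = (\<Sum>m<i. r m)"
      unfolding r_def
      by (intro sum.cong refl law_settled_eq[OF kernel_error_settled[OF n g]]) (use n in auto)
    also have "2 + (\<integral>h. \<bar>mart n g i h\<bar> \<partial>law i) + (\<Sum>m<i. r m) \<le> 2 + 5 / 2 * sqrt (real (i + 1)) + (\<Sum>m<i. r m)"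
      using mart_first_moment[OF n g, of i] by simp
    finally have "(\<integral>h. \<bar>?L h\<bar> \<partial>law i) / real (i + 1) \<le> (2 + 5 / 2 * sqrt (real (i + 1)) + (\<Sum>m<i. r m)) / real (i + 1)"
      by (rule divide_right_mono) simp
    also have "\<dots> = 2 / real (i + 1) + 5 / 2 * (sqrt (real (i + 1)) / real (i + 1)) + (\<Sum>m<i. r m) / real (i + 1)"
      by (simp only: add_divide_distrib times_divide_eq_right)
    also have "sqrt (real (i + 1)) / real (i + 1) = 1 / sqrt (real (i + 1))"
      by (simp only: sqrt_divide_self_eq of_nat_0_le_iff inverse_eq_divide)
    finally show ?thesis by (simp add: abs_divide)
  qed
  then show "\<forall>\<^sub>F i in sequentially. (\<integral>h. \<bar>(\<Sum>m\<le>i. g (h (n, m)) - K n g (h (n, m))) / real (i + 1)\<bar> \<partial>law i)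
      \<le> 2 / real (i + 1) + 5 / 2 * (1 / sqrt (real (i + 1))) + (\<Sum>m<i. r m) / real (i + 1)" by simp
qed simp

text \<open>Telescoping splits \<open>f\<close> into \<open>k\<close> coboundaries
  \<open>G j - K n (G j)\<close>, whose averages vanish by \<open>ergodic_coboundary\<close>, and
  \<open>G k\<close>, which is within \<open>e\<close> of the target mean on the support.
  \<open>k\<close> is chosen from \<open>e\<close> before \<open>i\<close> grows.\<close>

lemma ergodic_average:
  assumes n: "n \<in> {1..P}" and f: "f \<in> unit_ball (S n)" and pc: "proposal_converges n"
  shows "(\<lambda>i. \<integral>h. \<bar>(\<Sum>m\<le>i. f (h (n, m))) / real (i + 1) - (\<integral>x. f x \<partial>tgt n)\<bar> \<partial>law i) \<longlonglongrightarrow> 0"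
proof (rule tendsto_0_if_le_approx)
  fix e :: real assume e: "e > 0"
  obtain r where r: "0 \<le> r" "r < 1"
    and rK: "\<And>g k x. g \<in> unit_ball (S n) \<Longrightarrow> x \<in> supp n \<Longrightarrow> \<bar>(K n ^^ k) g x - (\<integral>x. g x \<partial>tgt n)\<bar> \<le> 2 * r ^ k"
    using K_power_converges[OF n] by metis
  have "(\<lambda>k. 2 * r ^ k) \<longlonglongrightarrow> 2 * 0" by (intro tendsto_mult_left LIMSEQ_power_zero) (use r in auto)
  then obtain k where k: "2 * r ^ k < e"
    using order_tendstoD(2)[of "\<lambda>k. 2 * r ^ k" 0 sequentially e] e by (auto simp: eventually_sequentially)
  define G where "G j = (K n ^^ j) f" for j
  have Gu: "G j \<in> unit_ball (S n)" for j unfolding G_def using K_power_unit_ball[OF n f] .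
  have GS: "K n (G j) = G (Suc j)" for j by (simp add: G_def)
  define L where "L j i h = \<bar>(\<Sum>m\<le>i. G j (h (n, m)) - K n (G j) (h (n, m))) / real (i + 1)\<bar>" for j i h
  have m: "(\<lambda>h. g (h (n, m))) \<in> borel_measurable T" if "g \<in> unit_ball (S n)" for g m
    using measurable_compose[OF coord_measurable[OF n] unit_ball_measurable[OF that]] .
  have b: "\<bar>g (h (n, m))\<bar> \<le> 1" if "g \<in> unit_ball (S n)" "h \<in> space T" for g h m
    using unit_ball_bound[OF that(1) coord_space[OF n that(2)]] .
  have iL: "integrable (law i) (L j i)" for j i
  proof -
    have 1: "integrable (law i) (\<lambda>h. G j (h (n, m')))" for m' j by (rule law_integrable[OF m b]) (rule Gu)+
    show ?thesis unfolding L_def GS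
      by (intro integrable_abs integrable_divide Bochner_Integration.integrable_sum Bochner_Integration.integrable_diff 1)
  qed
  have "(\<integral>h. \<bar>(\<Sum>m\<le>i. f (h (n, m))) / real (i + 1) - (\<integral>x. f x \<partial>tgt n)\<bar> \<partial>law i)
      \<le> e + (\<Sum>j<k. \<integral>h. L j i h \<partial>law i)" for i
  proof -
    interpret prob_space "law i" by (rule prob_law)
    have "(\<integral>h. \<bar>(\<Sum>m\<le>i. f (h (n, m))) / real (i + 1) - (\<integral>x. f x \<partial>tgt n)\<bar> \<partial>law i)
      \<le> (\<integral>h. e + (\<Sum>j<k. L j i h) \<partial>law i)"
    proof (rule integral_mono_AE)
      show "integrable (law i) (\<lambda>h. e + (\<Sum>j<k. L j i h))" using iL by auto
      have "integrable (law i) (\<lambda>h. f (h (n, m')))" for m' by (rule law_integrable[OF m b]) (rule f)+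
      then show "integrable (law i) (\<lambda>h. \<bar>(\<Sum>m\<le>i. f (h (n, m))) / real (i + 1) - (\<integral>x. f x \<partial>tgt n)\<bar>)"
        by (intro integrable_abs Bochner_Integration.integrable_diff integrable_divide Bochner_Integration.integrable_sum integrable_const) auto
      have "AE h in law i. \<forall>m\<in>{..i}. h (n, m) \<in> supp n"
        by (rule AE_finite_allI) (auto intro: AE_supp[OF n])
      then show "AE h in law i. \<bar>(\<Sum>m\<le>i. f (h (n, m))) / real (i + 1) - (\<integral>x. f x \<partial>tgt n)\<bar> \<le> e + (\<Sum>j<k. L j i h)"
      proof eventually_elim
        case (elim h)
        let ?\<pi> = "\<integral>x. f x \<partial>tgt n"
        have tel: "f x = (\<Sum>j<k. G j x - K n (G j) x) + G k x" for x
          unfolding GS by (induction k) (simp_all add: G_def)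
        have "(\<Sum>m\<le>i. f (h (n, m))) / real (i + 1) - ?\<pi>
            = (\<Sum>m\<le>i. f (h (n, m)) - ?\<pi>) / real (i + 1)"
          by (simp add: sum_subtractf field_simps)
        also have "(\<Sum>m\<le>i. f (h (n, m)) - ?\<pi>)
            = (\<Sum>m\<le>i. (\<Sum>j<k. G j (h (n, m)) - K n (G j) (h (n, m))) + (G k (h (n, m)) - ?\<pi>))"
          by (subst tel) (simp add: add_diff_eq)
        also have "\<dots> = (\<Sum>j<k. \<Sum>m\<le>i. G j (h (n, m)) - K n (G j) (h (n, m))) + (\<Sum>m\<le>i. G k (h (n, m)) - ?\<pi>)"
          unfolding sum.distrib by (subst sum.swap) simp
        finally have eq: "(\<Sum>m\<le>i. f (h (n, m))) / real (i + 1) - ?\<pi>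
            = (\<Sum>j<k. (\<Sum>m\<le>i. G j (h (n, m)) - K n (G j) (h (n, m))) / real (i + 1))
              + (\<Sum>m\<le>i. G k (h (n, m)) - ?\<pi>) / real (i + 1)"
          by (simp only: add_divide_distrib sum_divide_distrib)
        have "\<bar>\<Sum>m\<le>i. G k (h (n, m)) - ?\<pi>\<bar> \<le> (\<Sum>m\<le>i. \<bar>G k (h (n, m)) - ?\<pi>\<bar>)" by (rule sum_abs)
        also have "\<dots> \<le> (\<Sum>m\<le>i. e)"
        proof (rule sum_mono)
          fix m assume "m \<in> {..i}"
          then have "h (n, m) \<in> supp n" using elim by blast
          then show "\<bar>G k (h (n, m)) - ?\<pi>\<bar> \<le> e" using rK[OF f, of "h (n, m)" k] k unfolding G_def by linarith
        qed
        also have "\<dots> = e * real (i + 1)" by simp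
        finally have "\<bar>(\<Sum>m\<le>i. G k (h (n, m)) - ?\<pi>) / real (i + 1)\<bar> \<le> e"
          by (simp add: abs_divide divide_le_eq)
        moreover have "\<bar>\<Sum>j<k. (\<Sum>m\<le>i. G j (h (n, m)) - K n (G j) (h (n, m))) / real (i + 1)\<bar> \<le> (\<Sum>j<k. L j i h)"
          unfolding L_def by (rule sum_abs)
        ultimately show ?case unfolding eq by linarith
      qed
    qed
    also have "\<dots> = e + (\<Sum>j<k. \<integral>h. L j i h \<partial>law i)" using iL prob_space by simp
    finally show ?thesis .
  qed
  moreover have "(\<lambda>i. \<Sum>j<k. \<integral>h. L j i h \<partial>law i) \<longlonglongrightarrow> (\<Sum>j<k. 0)"
    unfolding L_def by (intro tendsto_sum ergodic_coboundary[OF n Gu pc])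
  ultimately show "\<exists>v. v \<longlonglongrightarrow> 0 \<and> (\<forall>i. (\<integral>h. \<bar>(\<Sum>m\<le>i. f (h (n, m))) / real (i + 1) - (\<integral>x. f x \<partial>tgt n)\<bar> \<partial>law i) \<le> e + v i)"
    by (intro exI[of _ "\<lambda>i. \<Sum>j<k. \<integral>h. L j i h \<partial>law i"]) auto
qed simp

section \<open>Induction over the levels and convergence in law\<close>

lemma integral_tgt_0:
  assumes "f \<in> borel_measurable (S 0)"
  shows "(\<integral>x. f x \<partial>tgt 0) = (f (\<lambda>_. undefined) :: real)"
  using integral_tgt[OF _ assms] by (simp add: ref_0 g_0 Z_0 lebesgue_integral_count_space_finite)

text \<open>Integrating \<open>\<phi>\<close> against \<open>kern\<close> turns the proposal
  integral at level \<open>n + 1\<close> into an ergodic average of \<open>f\<close> at level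
  \<open>n\<close>, and the integral over \<open>eta\<close> into the target mean of
  \<open>f\<close>. At the bottom, the proposal at level 1 is exact.\<close>

lemma proposal_converges:
  assumes "n \<in> {1..P}" shows "proposal_converges n"
  using assms
proof (induction n)
  case (Suc n)
  show ?case
    unfolding proposal_converges_def
  proof
    fix \<phi> assume \<phi>: "\<phi> \<in> unit_ball (S (Suc n))"
    define f where "f x = (\<integral>y. \<phi> y \<partial>kern (Suc n) x)" for x
    have f: "f \<in> unit_ball (S n)"
      unfolding f_def using integral_kern_unit_ball[OF Suc.prems \<phi>] by simp
    have eta: "(\<integral>y. \<phi> y \<partial>eta (Suc n)) = (\<integral>x. f x \<partial>tgt n)"
      unfolding f_def using integral_eta[OF Suc.prems unit_ball_measurable[OF \<phi>] unit_ball_bound[OF \<phi>]] by simp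
    have pr: "(\<integral>y. \<phi> y \<partial>proposal E \<nu> q h (Suc n) i) = (\<Sum>m\<le>i. f (parent (Suc n) h m)) / real (i + 1)"
      if "h \<in> space T" for h i
      unfolding f_def
      using integral_proposal[OF Suc.prems that unit_ball_measurable[OF \<phi>] unit_ball_bound[OF \<phi>]] .
    show "(\<lambda>i. \<integral>h. \<bar>(\<integral>y. \<phi> y \<partial>proposal E \<nu> q h (Suc n) i) - (\<integral>y. \<phi> y \<partial>eta (Suc n))\<bar> \<partial>law i) \<longlonglongrightarrow> 0"
    proof (cases "n = 0")
      case True
      have "(\<integral>h. \<bar>(\<integral>y. \<phi> y \<partial>proposal E \<nu> q h (Suc n) i) - (\<integral>y. \<phi> y \<partial>eta (Suc n))\<bar> \<partial>law i) = (\<integral>h. 0 \<partial>law i)" for i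
      proof (rule Bochner_Integration.integral_cong[OF refl])
        fix h assume "h \<in> space (law i)"
        then have h: "h \<in> space T" by simp
        have "(\<integral>x. f x \<partial>tgt n) = f (\<lambda>_. undefined)"
          using f True by (simp add: integral_tgt_0 unit_ball_measurable)
        moreover have "parent (Suc n) h m = (\<lambda>_. undefined)" for m
          using True by (simp add: parent_def One_nat_def)
        ultimately show "\<bar>(\<integral>y. \<phi> y \<partial>proposal E \<nu> q h (Suc n) i) - (\<integral>y. \<phi> y \<partial>eta (Suc n))\<bar> = 0"
          unfolding pr[OF h] eta by (simp add: field_simps)
      qed
      then show ?thesis by simp
    next
      case False
      then have n: "n \<in> {1..P}" using Suc.prems by auto
      have "(\<integral>h. \<bar>(\<integral>y. \<phi> y \<partial>proposal E \<nu> q h (Suc n) i) - (\<integral>y. \<phi> y \<partial>eta (Suc n))\<bar> \<partial>law i)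
          = (\<integral>h. \<bar>(\<Sum>m\<le>i. f (h (n, m))) / real (i + 1) - (\<integral>x. f x \<partial>tgt n)\<bar> \<partial>law i)" for i
        by (rule Bochner_Integration.integral_cong[OF refl]) (use False in \<open>simp add: pr eta parent_def One_nat_def\<close>)
      then show ?thesis using ergodic_average[OF n f Suc.IH[OF n]] by simp
    qed
  qed
qed simp

text \<open>The last \<open>k\<close> random kernels are replaced one by one by the limit kernel,
  with an error that vanishes for fixed \<open>k\<close>; after \<open>k\<close> applications of
  \<open>K n\<close> the distance to the target mean is at most \<open>2 * r ^ k\<close>, from any
  state in the support.\<close>

lemma law_of_state_converges:
  assumes n: "n \<in> {1..P}" and f: "f \<in> unit_ball (S n)"
  shows "(\<lambda>i. \<integral>h. f (h (n, i)) \<partial>law i) \<longlonglongrightarrow> (\<integral>x. f x \<partial>tgt n)"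
proof -
  define b where "b g i = (\<integral>h. g (h (n, i)) \<partial>law i)" for g :: "(nat \<Rightarrow> 'a) \<Rightarrow> real" and i
  obtain r where r: "0 \<le> r" "r < 1"
    and rK: "\<And>g k x. g \<in> unit_ball (S n) \<Longrightarrow> x \<in> supp n \<Longrightarrow> \<bar>(K n ^^ k) g x - (\<integral>x. g x \<partial>tgt n)\<bar> \<le> 2 * r ^ k"
    using K_power_converges[OF n] by metis
  \<comment> \<open>By the Markov property with the constant factor 1 this difference is the mean of
    \<open>kernel_error\<close>; the expectation of \<open>K n g\<close> may be taken under the next
    law, since time \<open>i\<close> is settled.\<close>
  have step: "(\<lambda>i. b g (Suc i) - b (K n g) i) \<longlonglongrightarrow> 0" if g: "g \<in> unit_ball (S n)" for g
  proof (rule Lim_null_comparison[OF _ kernel_error_tendsto[OF n g proposal_converges[OF n]]], rule always_eventually, rule allI)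
    fix i
    note Kg = K_unit_ball[OF n g]
    let ?M = "\<lambda>h. mh n (proposal E \<nu> q h n (Suc i)) g (h (n, i))"
    have s: "settled i (n - 1) (\<lambda>_. 1)" by (auto simp: settled_def intro!: exI[of _ 1])
    have "b g (Suc i) = (\<integral>h. ?M h \<partial>law (Suc i))"
      unfolding b_def using markov_property[OF n _ s g, of "Suc i"] by simp
    moreover have "b (K n g) i = (\<integral>h. K n g (h (n, i)) \<partial>law (Suc i))"
      unfolding b_def by (rule law_settled_0[symmetric, OF settled_eval'[OF n Kg]]) auto
    moreover have "integrable (law (Suc i)) ?M"
      using mh_measurable[OF n proposal_measurable[OF n] coord_measurable[OF n] unit_ball_measurable[OF g]]
        mh_bound[OF n proposal_space[OF n] g coord_space[OF n]] by (rule law_integrable)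
    moreover have "integrable (law (Suc i)) (\<lambda>h. K n g (h (n, i)))"
      using measurable_compose[OF coord_measurable[OF n] unit_ball_measurable[OF Kg]]
        unit_ball_bound[OF Kg coord_space[OF n]] by (rule law_integrable)
    ultimately have "b g (Suc i) - b (K n g) i = (\<integral>h. kernel_error n g i h \<partial>law (Suc i))"
      by (simp add: kernel_error_def)
    then show "norm (b g (Suc i) - b (K n g) i) \<le> (\<integral>h. \<bar>kernel_error n g i h\<bar> \<partial>law (Suc i))" by simp
  qed
  have steps: "(\<lambda>i. b f (i + k) - b ((K n ^^ k) f) i) \<longlonglongrightarrow> 0" for k
  proof (induction k)
    case (Suc k)
    \<comment> \<open>One more kernel is replaced at the early end: the induction hypothesis is
      shifted to time \<open>i + 1\<close>, and \<open>step\<close> is applied to the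
      \<open>k\<close>-th iterate.\<close>
    have "(\<lambda>i. (b f (Suc i + k) - b ((K n ^^ k) f) (Suc i)) + (b ((K n ^^ k) f) (Suc i) - b (K n ((K n ^^ k) f)) i)) \<longlonglongrightarrow> 0 + 0"
      by (intro tendsto_add LIMSEQ_Suc[OF Suc.IH] step K_power_unit_ball[OF n f])
    then show ?case by simp
  qed simp
  show ?thesis
  proof (rule LIMSEQ_I)
    fix e :: real assume e: "e > 0"
    have "(\<lambda>k. 2 * r ^ k) \<longlonglongrightarrow> 2 * 0" by (intro tendsto_mult_left LIMSEQ_power_zero) (use r in auto)
    then obtain k where k: "2 * r ^ k < e / 2"
      using order_tendstoD(2)[of "\<lambda>k. 2 * r ^ k" 0 sequentially "e / 2"] e by (auto simp: eventually_sequentially)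
    \<comment> \<open>\<open>N\<close> may depend on \<open>k\<close>, which was fixed by the
      accuracy alone.\<close>
    obtain N where N: "\<And>i. i \<ge> N \<Longrightarrow> \<bar>b f (i + k) - b ((K n ^^ k) f) i\<bar> < e / 2"
      using LIMSEQ_D[OF steps[of k], of "e / 2"] e by auto
    have lim: "\<bar>b ((K n ^^ k) f) i - (\<integral>x. f x \<partial>tgt n)\<bar> \<le> 2 * r ^ k" for i
    proof -
      interpret prob_space "law i" by (rule prob_law)
      note Kf = K_power_unit_ball[OF n f, of k]
      have int: "integrable (law i) (\<lambda>h. (K n ^^ k) f (h (n, i)))"
        using measurable_compose[OF coord_measurable[OF n] unit_ball_measurable[OF Kf]]
          unit_ball_bound[OF Kf coord_space[OF n]] by (rule law_integrable)
      have eq: "b ((K n ^^ k) f) i - (\<integral>x. f x \<partial>tgt n) = (\<integral>h. (K n ^^ k) f (h (n, i)) - (\<integral>x. f x \<partial>tgt n) \<partial>law i)"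
        unfolding b_def using int prob_space by simp
      have "\<bar>b ((K n ^^ k) f) i - (\<integral>x. f x \<partial>tgt n)\<bar> \<le> (\<integral>h. \<bar>(K n ^^ k) f (h (n, i)) - (\<integral>x. f x \<partial>tgt n)\<bar> \<partial>law i)"
        unfolding eq by (rule integral_abs_bound)
      also have "\<dots> \<le> 2 * r ^ k"
      proof (rule integral_le_const)
        show "AE h in law i. \<bar>(K n ^^ k) f (h (n, i)) - (\<integral>x. f x \<partial>tgt n)\<bar> \<le> 2 * r ^ k"
          using AE_supp[OF n order_refl, of i]
        proof eventually_elim
          case (elim h)
          show ?case using rK[OF f elim, of k] .
        qed
        show "integrable (law i) (\<lambda>h. \<bar>(K n ^^ k) f (h (n, i)) - (\<integral>x. f x \<partial>tgt n)\<bar>)"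
          using int by (intro integrable_abs Bochner_Integration.integrable_diff integrable_const)
      qed
      finally show ?thesis .
    qed
    have "norm (b f i - (\<integral>x. f x \<partial>tgt n)) < e" if "i \<ge> N + k" for i
    proof -
      have "i - k + k = i" "N \<le> i - k" using that by auto
      then have "\<bar>b f i - b ((K n ^^ k) f) (i - k)\<bar> < e / 2" using N[of "i - k"] by simp
      then show ?thesis using lim[of "i - k"] k unfolding real_norm_def by linarith
    qed
    then show "\<exists>no. \<forall>i\<ge>no. norm ((\<integral>h. f (h (n, i)) \<partial>law i) - (\<integral>x. f x \<partial>tgt n)) < e"
      unfolding b_def by blast
  qed
qed

end

section \<open>Resetting \<open>\<gamma> 0\<close> to a constant\<close>

lemma weight_upd_0: "k \<ge> 1 \<Longrightarrow> weight (\<gamma>(0 := c)) q k = weight \<gamma> q k"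
  by (rule ext) (auto simp: weight_def)

lemma update_level_upd_0:
  "k \<ge> 1 \<Longrightarrow> update_level E \<nu> (\<gamma>(0 := c)) q P i k = update_level E \<nu> \<gamma> q P i k"
  by (rule ext) (simp add: update_level_def accept_prob_def weight_upd_0)

lemma update_levels_upd_0: "update_levels E \<nu> (\<gamma>(0 := c)) q P i k = update_levels E \<nu> \<gamma> q P i k"
proof (induction k)
  case (Suc k)
  show ?case by (rule ext) (simp add: Suc update_level_upd_0 del: fun_upd_apply)
qed auto

lemma simcmc_upd_0: "simcmc E \<nu> (\<gamma>(0 := c)) q P x0 i = simcmc E \<nu> \<gamma> q P x0 i"
  by (induction i) (simp_all add: update_levels_upd_0 simcmc.simps del: fun_upd_apply)

lemma target_upd_0:
  assumes "k \<ge> 1"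
  shows "target \<nu> (\<gamma>(0 := c)) k = target \<nu> \<gamma> k" "norm_const \<nu> (\<gamma>(0 := c)) k = norm_const \<nu> \<gamma> k"
    "target_support E \<nu> (\<gamma>(0 := c)) k = target_support E \<nu> \<gamma> k"
  using assms by (auto simp: target_def target_density_def norm_const_def target_support_def)

theorem theorem3p3:
  fixes E :: "'a measure"
    and \<nu> :: "nat \<Rightarrow> 'a measure"
    and \<gamma> :: "nat \<Rightarrow> (nat \<Rightarrow> 'a) \<Rightarrow> real"
    and q :: "nat \<Rightarrow> (nat \<Rightarrow> 'a) \<Rightarrow> 'a \<Rightarrow> real"
    and P n :: nat
    and x0 :: "nat \<Rightarrow> nat \<Rightarrow> 'a"
    and f :: "(nat \<Rightarrow> 'a) \<Rightarrow> real"
  assumes "P \<ge> 1"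
    and "\<And>k. k \<in> {1..P} \<Longrightarrow> sigma_finite_measure (\<nu> k)"
    and "\<And>k. k \<in> {1..P} \<Longrightarrow> sets (\<nu> k) = sets E"
    and "\<And>k x. k \<in> {1..P} \<Longrightarrow> x \<in> space (path_space E k) \<Longrightarrow> \<gamma> k x \<ge> 0"
    and "\<And>k. k \<in> {1..P} \<Longrightarrow> integrable (ref_measure \<nu> k) (\<gamma> k)"
    and "\<And>k. k \<in> {1..P} \<Longrightarrow> norm_const \<nu> \<gamma> k > 0"
    and "\<And>k. k \<in> {1..P} \<Longrightarrow>
          (\<lambda>(x, y). q k x y) \<in> borel_measurable (path_space E (k - 1) \<Otimes>\<^sub>M E)"
    and "\<And>k x y. k \<in> {1..P} \<Longrightarrow> x \<in> space (path_space E (k - 1)) \<Longrightarrow> y \<in> space E \<Longrightarrow> q k x y \<ge> 0"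
    and "\<And>k x. k \<in> {1..P} \<Longrightarrow> x \<in> space (path_space E (k - 1)) \<Longrightarrow>
          (\<integral>\<^sup>+ y. ennreal (q k x y) \<partial>\<nu> k) = 1"
    and "\<forall>k \<in> {1..P}. \<exists>B :: real. \<forall>x \<in> target_support E \<nu> \<gamma> k. weight \<gamma> q k x \<le> ennreal B"
    and "n \<in> {1..P}"
    and "\<And>k. k \<in> {1..P} \<Longrightarrow> x0 k \<in> target_support E \<nu> \<gamma> k"
    and "f \<in> borel_measurable (path_space E n)"
    and "\<And>x. x \<in> space (path_space E n) \<Longrightarrow> \<bar>f x\<bar> \<le> 1"
  shows "(\<lambda>i. \<integral>h. f (h (n, i)) \<partial>simcmc E \<nu> \<gamma> q P x0 i)
           \<longlonglongrightarrow> (\<integral>x. f x \<partial>target \<nu> \<gamma> n)"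
proof -
  \<comment> \<open>The locale is entered with \<open>\<gamma> 0\<close> reset to 1. Level 1 has its
    own branch in \<open>weight\<close>, and higher levels read \<open>\<gamma>\<close> at indices
    at least 1, so the algorithm, the targets and the weights from level 1 on stay the same.\<close>
  interpret simcmc_setup E \<nu> "\<gamma>(0 := (\<lambda>_. 1))" q P x0
  proof (rule simcmc_setup.intro)
    show "\<forall>k\<in>{1..P}. \<exists>B::real. \<forall>x\<in>target_support E \<nu> (\<gamma>(0 := (\<lambda>_. 1))) k.
        weight (\<gamma>(0 := (\<lambda>_. 1))) q k x \<le> ennreal B"
      using assms(10) by (simp add: target_upd_0 weight_upd_0)
  qed (use assms(2-9,12) in \<open>simp_all add: target_upd_0\<close>)
  have "f \<in> unit_ball (path_space E n)" using assms(13,14) by (rule unit_ballI)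
  from law_of_state_converges[OF assms(11) this] show ?thesis
    using assms(11) by (simp add: simcmc_upd_0 target_upd_0)
qed

end
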